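(* Let $\Delta$ be a finite polar space of rank $n\ge 3$ and order $(s,\dots,s,t)$, and let $(n-2)/2\le i<j\le n-1$. Then $(\Delta_i,\perp)\not\cong(\Delta_j,\perp)$, $(\Delta_i,\perp\cup\approx)\not\cong(\Delta_j,\perp\cup\approx)$ and $(\Delta_i,\perp_{\max})\not\cong(\Delta_j,\perp_{\max})$.
   Context: $\Delta$ is a finite non-degenerate polar space of rank $n\ge3$ of order $(s,\dots,s,t)$: $s,t$ are positive integers with $s>1$ and $t\in\{1,s^{1/2},s,s^{3/2},s^2\}$, every line has $s+1$ points and every singular subspace of projective dimension $n-2$ lies in exactly $t+1$ maximal singular subspaces (which have projective dimension $n-1$). $\Delta_u$ is the set of singular subspaces of projective dimension $u$. For $X,Y\in\Delta_u$: $X\perp Y$ means every point of $X$ is collinear with every point of $Y$; $X\approx Y$ means $\dim(X\cap Y)=u-1$; $X\perp_{\max}Y$ means $X\perp Y$ and $\dim\langle X,Y\rangle=n-1$. $(\Delta_u,\perp)$, $(\Delta_u,\perp\cup\approx)$, $(\Delta_u,\perp_{\max})$ are the graphs on vertex set $\Delta_u$ in which distinct $X,Y$ are adjacent iff respectively $X\perp Y$; $X\perp Y$ or $X\approx Y$; $X\perp_{\max}Y$. *)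

theory Defs
  imports Complex_Main "Graph_Theory.Graph_Theory"
begin

text \<open>
  A point-line geometry is given by a set \<open>P\<close> of points and a set \<open>L\<close> of lines, each line being
  the set of its points.  Every point counts as collinear with itself.
\<close>

definition pt_collinear :: "'a set set \<Rightarrow> 'a \<Rightarrow> 'a \<Rightarrow> bool" where
  "pt_collinear L p q \<longleftrightarrow> p = q \<or> (\<exists>l\<in>L. p \<in> l \<and> q \<in> l)"

text \<open>
  The Buekenhout-Shult axioms.  Since \<open>P\<close> is finite, the axiom that nested sequences of singular
  subspaces are finite holds automatically.  Partial linearity is redundant: it follows from the
  other axioms (Buekenhout and Shult).
\<close>

locale finite_polar_space =
  fixes P :: "'a set" and L :: "'a set set"
  assumes finite_points: "finite P"
    and line_subset: "\<And>l. l \<in> L \<Longrightarrow> l \<subseteq> P"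
    and line_card_ge_3: "\<And>l. l \<in> L \<Longrightarrow> card l \<ge> 3"
    and partial_linear:
      "\<And>l m p q. \<lbrakk>l \<in> L; m \<in> L; p \<noteq> q; p \<in> l; q \<in> l; p \<in> m; q \<in> m\<rbrakk> \<Longrightarrow> l = m"
    and one_or_all:
      "\<And>p l. \<lbrakk>p \<in> P; l \<in> L\<rbrakk> \<Longrightarrow>
         (\<exists>!q. q \<in> l \<and> pt_collinear L p q) \<or> (\<forall>q\<in>l. pt_collinear L p q)"
    and nondegenerate: "\<And>p. p \<in> P \<Longrightarrow> \<exists>q\<in>P. \<not> pt_collinear L p q"

definition geom_subspace :: "'a set \<Rightarrow> 'a set set \<Rightarrow> 'a set \<Rightarrow> bool" where
  "geom_subspace P L S \<longleftrightarrow>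
     S \<subseteq> P \<and> (\<forall>l\<in>L. \<forall>p\<in>S. \<forall>q\<in>S. p \<noteq> q \<and> p \<in> l \<and> q \<in> l \<longrightarrow> l \<subseteq> S)"

definition geom_span :: "'a set \<Rightarrow> 'a set set \<Rightarrow> 'a set \<Rightarrow> 'a set" where
  "geom_span P L A = \<Inter>{S. geom_subspace P L S \<and> A \<subseteq> S}"

definition perp :: "'a set set \<Rightarrow> 'a set \<Rightarrow> 'a set \<Rightarrow> bool" where
  "perp L X Y \<longleftrightarrow> (\<forall>x\<in>X. \<forall>y\<in>Y. pt_collinear L x y)"

definition singular_subspace :: "'a set \<Rightarrow> 'a set set \<Rightarrow> 'a set \<Rightarrow> bool" where
  "singular_subspace P L X \<longleftrightarrow> geom_subspace P L X \<and> perp L X X"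

definition maximal_singular :: "'a set \<Rightarrow> 'a set set \<Rightarrow> 'a set \<Rightarrow> bool" where
  "maximal_singular P L M \<longleftrightarrow>
     singular_subspace P L M \<and> (\<forall>X. singular_subspace P L X \<and> M \<subseteq> X \<longrightarrow> X = M)"

text \<open>
  Projective dimension: one less than the least number of points that generate the subspace, so
  the empty subspace has dimension \<open>-1\<close>, points have dimension \<open>0\<close> and lines dimension \<open>1\<close>.
\<close>

definition proj_dim :: "'a set \<Rightarrow> 'a set set \<Rightarrow> 'a set \<Rightarrow> int" where
  "proj_dim P L X =
     int (LEAST k. \<exists>A. A \<subseteq> X \<and> finite A \<and> card A = k \<and> geom_span P L A = X) - 1"

definition has_polar_rank :: "'a set \<Rightarrow> 'a set set \<Rightarrow> nat \<Rightarrow> bool" where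
  "has_polar_rank P L n \<longleftrightarrow> (\<forall>M. maximal_singular P L M \<longrightarrow> proj_dim P L M = int n - 1)"

text \<open>
  Order \<open>(s, \<dots>, s, t)\<close> of a polar space of rank \<open>n\<close>, including the standing restriction on the
  possible values of \<open>t\<close>.
\<close>

definition has_polar_order :: "'a set \<Rightarrow> 'a set set \<Rightarrow> nat \<Rightarrow> nat \<Rightarrow> nat \<Rightarrow> bool" where
  "has_polar_order P L n s t \<longleftrightarrow>
     1 < s \<and> 0 < t \<and>
     real t \<in> {1, real s powr (1/2), real s, real s powr (3/2), real s ^ 2} \<and>
     (\<forall>l\<in>L. card l = s + 1) \<and>
     (\<forall>U. singular_subspace P L U \<and> proj_dim P L U = int n - 2 \<longrightarrow>
        card {M. maximal_singular P L M \<and> U \<subseteq> M} = t + 1)"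

definition Delta :: "'a set \<Rightarrow> 'a set set \<Rightarrow> nat \<Rightarrow> 'a set set" where
  "Delta P L u = {X. singular_subspace P L X \<and> proj_dim P L X = int u}"

definition hyp_adjacent :: "'a set \<Rightarrow> 'a set set \<Rightarrow> nat \<Rightarrow> 'a set \<Rightarrow> 'a set \<Rightarrow> bool" where
  "hyp_adjacent P L u X Y \<longleftrightarrow> proj_dim P L (X \<inter> Y) = int u - 1"

definition perp_max :: "'a set \<Rightarrow> 'a set set \<Rightarrow> nat \<Rightarrow> 'a set \<Rightarrow> 'a set \<Rightarrow> bool" where
  "perp_max P L n X Y \<longleftrightarrow> perp L X Y \<and> proj_dim P L (geom_span P L (X \<union> Y)) = int n - 1"

text \<open>
  The simple graph on \<open>V\<close> in which distinct vertices are adjacent iff they are related by \<open>R\<close>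
  (for symmetric \<open>R\<close>), encoded as a digraph with both arcs for each edge.
\<close>

definition graph_of :: "'b set \<Rightarrow> ('b \<Rightarrow> 'b \<Rightarrow> bool) \<Rightarrow> 'b pair_pre_digraph" where
  "graph_of V R = \<lparr>pverts = V, parcs = {(x, y). x \<in> V \<and> y \<in> V \<and> x \<noteq> y \<and> R x y}\<rparr>"

abbreviation graph_iso :: "'b pair_pre_digraph \<Rightarrow> 'c pair_pre_digraph \<Rightarrow> bool" where
  "graph_iso G H \<equiv> digraph_iso (with_proj G) (with_proj H)"

lemma graph_iso_graph_of_iff:
  "graph_iso (graph_of V R) (graph_of W S) \<longleftrightarrow>
     (\<exists>f. bij_betw f V W \<and>
       (\<forall>x\<in>V. \<forall>y\<in>V. x \<noteq> y \<longrightarrow> (R x y \<longleftrightarrow> S (f x) (f y))))" (is "?l \<longleftrightarrow> ?r")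
proof
  assume ?l
  then obtain h where
    h: "pre_digraph.digraph_isomorphism (with_proj (graph_of V R)) h"
    and eq: "with_proj (graph_of W S) = app_iso h (with_proj (graph_of V R))"
    unfolding digraph_iso_def by blast
  let ?f = "iso_verts h"
  let ?A = "parcs (graph_of V R)" and ?B = "parcs (graph_of W S)"
  have inj: "inj_on ?f V"
    using h by (simp add: pre_digraph.digraph_isomorphism_def graph_of_def)
  have W: "W = ?f ` V"
    using arg_cong[OF eq, of verts] by (simp add: graph_of_def)
  have B: "?B = iso_arcs h ` ?A"
    using arg_cong[OF eq, of arcs] by simp
  have hd: "iso_tail h = fst" "iso_head h = snd"
    using arg_cong[OF eq, of tail] arg_cong[OF eq, of head] by simp_all
  have arc: "iso_arcs h a = (?f (fst a), ?f (snd a))" if "a \<in> ?A" for a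
    using h that by (simp add: pre_digraph.digraph_isomorphism_def hd prod_eq_iff)
  have B': "?B = (\<lambda>a. (?f (fst a), ?f (snd a))) ` ?A"
    unfolding B by (rule image_cong) (simp_all add: arc)
  have "R x y \<longleftrightarrow> S (?f x) (?f y)" if xy: "x \<in> V" "y \<in> V" "x \<noteq> y" for x y
  proof -
    have "R x y \<longleftrightarrow> (x, y) \<in> ?A"
      using xy by (simp add: graph_of_def)
    also have "\<dots> \<longleftrightarrow> (?f x, ?f y) \<in> ?B"
      unfolding B' using xy inj by (auto simp: graph_of_def image_iff inj_on_eq_iff)
    also have "\<dots> \<longleftrightarrow> S (?f x) (?f y)"
      using xy inj by (auto simp: graph_of_def W inj_on_eq_iff)
    finally show ?thesis .
  qed
  then show ?r
    using inj W by (auto simp: bij_betw_def)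
next
  assume ?r
  then obtain f where f: "inj_on f V" "W = f ` V"
    and RS: "\<And>x y. x \<in> V \<Longrightarrow> y \<in> V \<Longrightarrow> x \<noteq> y \<Longrightarrow> R x y \<longleftrightarrow> S (f x) (f y)"
    by (auto simp: bij_betw_def)
  let ?h = "\<lparr>iso_verts = f, iso_arcs = map_prod f f, iso_head = snd, iso_tail = fst\<rparr>"
  have "wf_digraph (with_proj (graph_of V R))"
    by unfold_locales (auto simp: graph_of_def)
  moreover have "inj_on (map_prod f f) (parcs (graph_of V R))"
    using f(1) by (auto simp: graph_of_def inj_on_def)
  ultimately have "pre_digraph.digraph_isomorphism (with_proj (graph_of V R)) ?h"
    using f(1) by (simp add: pre_digraph.digraph_isomorphism_def) (simp add: graph_of_def)
  moreover have "parcs (graph_of W S) = map_prod f f ` parcs (graph_of V R)"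
    using f RS by (fastforce simp: graph_of_def inj_on_eq_iff image_iff)
  then have "with_proj (graph_of W S) = app_iso ?h (with_proj (graph_of V R))"
    using f(2) by (simp add: app_iso_def with_proj_def) (simp add: graph_of_def)
  ultimately show ?l
    unfolding digraph_iso_def by blast
qed

end

theory Submission
  imports Defs
begin

text \<open>
  In each of the three graphs the degree of a vertex \<open>X\<close> is determined by its vector space rank \<open>a\<close>,
  and it strictly decreases with \<open>a\<close> as long as \<open>n \<le> 2 * a\<close>.

  Let \<open>c = n - a\<close>, let \<open>[k]\<close> be the number of points of a singular subspace of rank \<open>k\<close>, let
  \<open>N r\<close> be the number of \<open>Y \<bottom> X\<close> of rank \<open>a\<close> such that \<open>X \<inter> Y\<close> has rank \<open>a - r\<close>, and let
  \<open>R c = [c] * (t * s ^ (c - 1) + 1)\<close> be the number of points of a polar space of rank \<open>c\<close>.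
  Such a \<open>Y\<close> is a complement of \<open>X\<close> in an interval from a subspace of corank \<open>r\<close> in \<open>X\<close> to one of
  rank \<open>a + r\<close> above \<open>X\<close>.  Each interval has \<open>s ^ (r * r)\<close> complements, which gives
  \<open>[r + 1]\<^sup>2 * N (r + 1) = s ^ (2 * r + 1) * [a - r] * R (c - r) * N r\<close>.
  The product \<open>[a - r] * R (c - r)\<close> does not increase with \<open>a\<close> in the given range, so neither does
  any \<open>N r\<close>.  The degrees are \<open>N 1 + N 2 + \<dots>\<close> for \<open>\<bottom>\<close>, where \<open>N c\<close> is the last nonzero summand;
  \<open>[a] * (R (c + 1) - 1) + N 2 + N 3 + \<dots>\<close> for \<open>\<bottom> \<union> \<approx>\<close>; and \<open>N c\<close> for \<open>\<bottom>\<^sub>m\<^sub>a\<^sub>x\<close> (if \<open>c > 0\<close>).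

  That singular subspaces are projective spaces is obtained from a separation property: a point
  outside a singular subspace \<open>X\<close> is not collinear with some point of \<open>X\<^sup>\<bottom>\<close>.
\<close>

subsection \<open>Collinearity, spans and orthogonality\<close>

lemma pt_collinear_refl [simp]: "pt_collinear L p p"
  by (simp add: pt_collinear_def)

lemma pt_collinear_commute: "pt_collinear L p q \<longleftrightarrow> pt_collinear L q p"
  by (auto simp: pt_collinear_def)

lemma pt_collinearI: "l \<in> L \<Longrightarrow> p \<in> l \<Longrightarrow> q \<in> l \<Longrightarrow> pt_collinear L p q"
  by (auto simp: pt_collinear_def)

lemma pt_collinearE:
  assumes "pt_collinear L p q" "p \<noteq> q"
  obtains l where "l \<in> L" "p \<in> l" "q \<in> l"
  using assms by (auto simp: pt_collinear_def)

lemma perp_commute: "perp L X Y \<longleftrightarrow> perp L Y X"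
  unfolding perp_def by (metis pt_collinear_commute)

lemma perp_subset: "perp L X Y \<Longrightarrow> X' \<subseteq> X \<Longrightarrow> Y' \<subseteq> Y \<Longrightarrow> perp L X' Y'"
  unfolding perp_def by blast

lemma geom_span_eq_hull: "geom_span P L A = geom_subspace P L hull A"
  by (simp add: geom_span_def hull_def)

lemma subset_geom_span: "A \<subseteq> geom_span P L A"
  by (simp add: geom_span_eq_hull hull_subset)

lemma geom_span_minimal: "A \<subseteq> S \<Longrightarrow> geom_subspace P L S \<Longrightarrow> geom_span P L A \<subseteq> S"
  by (simp add: geom_span_eq_hull hull_minimal)

lemma geom_span_eq: "geom_subspace P L S \<Longrightarrow> geom_span P L S = S"
  by (simp add: geom_span_eq_hull hull_same)

lemma geom_span_insert_span:
  "geom_span P L (insert p (geom_span P L A)) = geom_span P L (insert p A)"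
  unfolding geom_span_eq_hull by (rule hull_insert[symmetric])

lemma geom_span_redundant: "p \<in> geom_span P L A \<Longrightarrow> geom_span P L (insert p A) = geom_span P L A"
  unfolding geom_span_eq_hull by (rule hull_redundant)

lemma geom_subspace_subset_points: "geom_subspace P L S \<Longrightarrow> S \<subseteq> P"
  by (simp add: geom_subspace_def)

lemma geom_subspaceI:
  assumes "S \<subseteq> P"
    and "\<And>l p q r. \<lbrakk>l \<in> L; p \<in> S; q \<in> S; p \<noteq> q; p \<in> l; q \<in> l; r \<in> l\<rbrakk> \<Longrightarrow> r \<in> S"
  shows "geom_subspace P L S"
  using assms unfolding geom_subspace_def by blast

lemma geom_subspaceD:
  "\<lbrakk>geom_subspace P L S; l \<in> L; p \<in> S; q \<in> S; p \<noteq> q; p \<in> l; q \<in> l; r \<in> l\<rbrakk> \<Longrightarrow> r \<in> S"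
  unfolding geom_subspace_def by blast

lemma geom_subspace_Int:
  assumes "geom_subspace P L X" "geom_subspace P L Y"
  shows "geom_subspace P L (X \<inter> Y)"
proof (rule geom_subspaceI)
  show "X \<inter> Y \<subseteq> P" using geom_subspace_subset_points[OF assms(1)] by blast
  show "r \<in> X \<inter> Y"
    if "l \<in> L" "p \<in> X \<inter> Y" "q \<in> X \<inter> Y" "p \<noteq> q" "p \<in> l" "q \<in> l" "r \<in> l" for l p q r
    using geom_subspaceD[OF assms(1) that(1)] geom_subspaceD[OF assms(2) that(1)] that by blast
qed

lemma singular_imp_geom_subspace: "singular_subspace P L X \<Longrightarrow> geom_subspace P L X"
  by (simp add: singular_subspace_def)

lemma singular_subset_points: "singular_subspace P L X \<Longrightarrow> X \<subseteq> P"
  by (auto simp: singular_subspace_def dest: geom_subspace_subset_points)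

lemma singular_imp_perp: "singular_subspace P L Z \<Longrightarrow> X \<subseteq> Z \<Longrightarrow> Y \<subseteq> Z \<Longrightarrow> perp L X Y"
  unfolding singular_subspace_def by (blast intro: perp_subset)

lemma singular_Int:
  "singular_subspace P L X \<Longrightarrow> singular_subspace P L Y \<Longrightarrow> singular_subspace P L (X \<inter> Y)"
  unfolding singular_subspace_def by (auto intro: geom_subspace_Int perp_subset)

lemma singular_empty: "singular_subspace P L {}"
  by (simp add: singular_subspace_def geom_subspace_def perp_def)

lemma singular_span_minimal: "singular_subspace P L S \<Longrightarrow> A \<subseteq> S \<Longrightarrow> geom_span P L A \<subseteq> S"
  by (simp add: geom_span_minimal singular_imp_geom_subspace)

lemma singular_lineE:
  assumes X: "singular_subspace P L X" and pq: "p \<in> X" "q \<in> X" "p \<noteq> q"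
  obtains l where "l \<in> L" "p \<in> l" "q \<in> l" "l \<subseteq> X"
proof -
  have "pt_collinear L p q" using X pq by (simp add: singular_subspace_def perp_def)
  then obtain l where "l \<in> L" "p \<in> l" "q \<in> l" using pq(3) by (rule pt_collinearE)
  then show thesis
    using geom_subspaceD[OF singular_imp_geom_subspace[OF X]] pq that by blast
qed

definition orth :: "'a set \<Rightarrow> 'a set set \<Rightarrow> 'a set \<Rightarrow> 'a set" where
  "orth P L A = {z \<in> P. \<forall>a\<in>A. pt_collinear L a z}"

lemma mem_orth_iff: "z \<in> orth P L A \<longleftrightarrow> z \<in> P \<and> (\<forall>a\<in>A. pt_collinear L a z)"
  by (simp add: orth_def)

lemma orth_antimono: "A \<subseteq> B \<Longrightarrow> orth P L B \<subseteq> orth P L A"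
  by (auto simp: orth_def)

lemma perp_iff_subset_orth: "Y \<subseteq> P \<Longrightarrow> perp L X Y \<longleftrightarrow> Y \<subseteq> orth P L X"
  by (auto simp: orth_def perp_def)

lemma singular_subset_orth: "singular_subspace P L Z \<Longrightarrow> X \<subseteq> Z \<Longrightarrow> Z \<subseteq> orth P L X"
  by (simp add: perp_iff_subset_orth[symmetric] singular_imp_perp singular_subset_points)

definition lines_within :: "'a set set \<Rightarrow> 'a set \<Rightarrow> 'a set set" where
  "lines_within L R = {l \<in> L. l \<subseteq> R}"

context
  fixes P R :: "'a set" and L :: "'a set set"
  assumes R: "geom_subspace P L R"
begin

lemma pt_collinear_lines_within:
  assumes "x \<in> R" "y \<in> R"
  shows "pt_collinear (lines_within L R) x y \<longleftrightarrow> pt_collinear L x y"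
proof (cases "x = y")
  case False
  then have "l \<subseteq> R" if "l \<in> L" "x \<in> l" "y \<in> l" for l
    using geom_subspaceD[OF R] assms that by blast
  then show ?thesis unfolding pt_collinear_def lines_within_def by blast
qed simp

lemma perp_lines_within:
  "X \<subseteq> R \<Longrightarrow> Y \<subseteq> R \<Longrightarrow> perp (lines_within L R) X Y \<longleftrightarrow> perp L X Y"
  by (simp add: perp_def pt_collinear_lines_within subset_iff)

lemma orth_lines_within:
  assumes "X \<subseteq> R" shows "orth R (lines_within L R) X = R \<inter> orth P L X"
  using assms geom_subspace_subset_points[OF R] pt_collinear_lines_within
  by (auto simp: orth_def subset_iff)

lemma geom_subspace_lines_within:
  assumes "geom_subspace P L S"
  shows "geom_subspace R (lines_within L R) (R \<inter> S)"
proof (rule geom_subspaceI)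
  show "r \<in> R \<inter> S"
    if "l \<in> lines_within L R" "p \<in> R \<inter> S" "q \<in> R \<inter> S" "p \<noteq> q" "p \<in> l" "q \<in> l" "r \<in> l" for l p q r
    using geom_subspaceD[OF assms, of l p q r] that by (auto simp: lines_within_def)
qed simp

end

context finite_polar_space
begin

abbreviation sing :: "'a set \<Rightarrow> bool" where
  "sing \<equiv> singular_subspace P L"

abbreviation span_of :: "'a set \<Rightarrow> 'a set" ("\<langle>_\<rangle>") where
  "\<langle>A\<rangle> \<equiv> geom_span P L A"

abbreviation orth_of :: "'a set \<Rightarrow> 'a set" ("_\<^sup>\<bottom>" [1000] 999) where
  "A\<^sup>\<bottom> \<equiv> orth P L A"

lemma finite_sing: "sing X \<Longrightarrow> finite X"
  by (rule finite_subset[OF singular_subset_points finite_points])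

lemma finite_Collect_sing: "finite {X. sing X \<and> Q X}"
  by (rule finite_subset[of _ "Pow P"]) (use singular_subset_points[of P L] finite_points in auto)

lemma geom_subspace_points: "geom_subspace P L P"
  using line_subset by (auto simp: geom_subspace_def)

lemma geom_subspace_span:
  assumes "A \<subseteq> P" shows "geom_subspace P L \<langle>A\<rangle>"
proof (rule geom_subspaceI)
  show "\<langle>A\<rangle> \<subseteq> P" by (rule geom_span_minimal[OF assms geom_subspace_points])
  show "r \<in> \<langle>A\<rangle>"
    if "l \<in> L" "p \<in> \<langle>A\<rangle>" "q \<in> \<langle>A\<rangle>" "p \<noteq> q" "p \<in> l" "q \<in> l" "r \<in> l" for l p q r
    unfolding geom_span_def
  proof (intro InterI, clarify)
    fix S assume S: "geom_subspace P L S" "A \<subseteq> S"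
    then have "\<langle>A\<rangle> \<subseteq> S" by (rule geom_span_minimal[rotated])
    then show "r \<in> S" using geom_subspaceD[OF S(1) that(1)] that by blast
  qed
qed

lemma collinear_on_line:
  assumes "z \<in> P" "l \<in> L" "x \<in> l" "y \<in> l" "x \<noteq> y"
    and "pt_collinear L z x" "pt_collinear L z y" "w \<in> l"
  shows "pt_collinear L z w"
  using one_or_all[OF assms(1,2)] assms(3-) by blast

lemma line_meets_orth:
  assumes "z \<in> P" "l \<in> L"
  obtains q where "q \<in> l" "q \<in> {z}\<^sup>\<bottom>"
proof -
  have "l \<noteq> {}" using line_card_ge_3[OF assms(2)] by auto
  then obtain q where "q \<in> l" "pt_collinear L z q" using one_or_all[OF assms] by blast
  then show thesis using line_subset[OF assms(2)] by (intro that) (auto simp: mem_orth_iff)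
qed

lemma geom_subspace_orth:
  assumes "A \<subseteq> P" shows "geom_subspace P L (A\<^sup>\<bottom>)"
proof (rule geom_subspaceI)
  show "w \<in> A\<^sup>\<bottom>"
    if "l \<in> L" "p \<in> A\<^sup>\<bottom>" "q \<in> A\<^sup>\<bottom>" "p \<noteq> q" "p \<in> l" "q \<in> l" "w \<in> l" for l p q w
    using that assms line_subset collinear_on_line[of _ l p q w] by (auto simp: mem_orth_iff)
qed (auto simp: mem_orth_iff)

lemma orth_span:
  assumes "A \<subseteq> P" shows "\<langle>A\<rangle>\<^sup>\<bottom> = A\<^sup>\<bottom>"
proof
  show "A\<^sup>\<bottom> \<subseteq> \<langle>A\<rangle>\<^sup>\<bottom>"
  proof
    fix z assume z: "z \<in> A\<^sup>\<bottom>"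
    then have "A \<subseteq> {z}\<^sup>\<bottom>" using assms by (auto simp: mem_orth_iff pt_collinear_commute)
    then have "\<langle>A\<rangle> \<subseteq> {z}\<^sup>\<bottom>"
      using z by (intro geom_span_minimal geom_subspace_orth) (auto simp: mem_orth_iff)
    then show "z \<in> \<langle>A\<rangle>\<^sup>\<bottom>" using z by (auto simp: mem_orth_iff pt_collinear_commute)
  qed
qed (intro orth_antimono subset_geom_span)

lemma sing_span:
  assumes "A \<subseteq> P" "perp L A A" shows "sing \<langle>A\<rangle>"
proof -
  have A: "A \<subseteq> \<langle>A\<rangle>\<^sup>\<bottom>" using assms by (simp add: perp_iff_subset_orth orth_span)
  have S: "geom_subspace P L \<langle>A\<rangle>" by (rule geom_subspace_span[OF assms(1)])
  then have sub: "\<langle>A\<rangle> \<subseteq> P" by (simp add: geom_subspace_def)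
  have "\<langle>A\<rangle> \<subseteq> \<langle>A\<rangle>\<^sup>\<bottom>" by (rule geom_span_minimal[OF A geom_subspace_orth[OF sub]])
  then show ?thesis using S by (simp add: singular_subspace_def perp_iff_subset_orth[OF sub])
qed

lemma sing_span_insert:
  assumes "sing X" "p \<in> X\<^sup>\<bottom>" shows "sing \<langle>insert p X\<rangle>"
proof (rule sing_span)
  show "insert p X \<subseteq> P" using assms singular_subset_points[of P L X] by (auto simp: mem_orth_iff)
  show "perp L (insert p X) (insert p X)"
    using assms by (auto simp: singular_subspace_def perp_def mem_orth_iff pt_collinear_commute)
qed

subsection \<open>Separation of points from singular subspaces\<close>

lemma collinear_if_orth_subset_orth:
  assumes p: "p \<in> P" and m: "m \<in> P" and sub: "{p}\<^sup>\<bottom> \<subseteq> {m}\<^sup>\<bottom>"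
    and x: "x \<in> {m}\<^sup>\<bottom>" "\<not> pt_collinear L p x" and v: "pt_collinear L v x"
  shows "pt_collinear L m v"
proof (cases "v = x")
  case False
  then obtain k where k: "k \<in> L" "v \<in> k" "x \<in> k" using v by (auto elim: pt_collinearE)
  obtain g where g: "g \<in> k" "g \<in> {p}\<^sup>\<bottom>" using line_meets_orth[OF p k(1)] .
  have "g \<noteq> x" using g x by (auto simp: mem_orth_iff)
  then show ?thesis
    using collinear_on_line[OF m k(1) g(1) k(3) _ _ _ k(2)] sub g x by (auto simp: mem_orth_iff)
qed (use x in \<open>simp add: mem_orth_iff\<close>)

lemma orth_subset_orth_imp_eq:
  assumes p: "p \<in> P" and q: "q \<in> P" and sub: "{p}\<^sup>\<bottom> \<subseteq> {q}\<^sup>\<bottom>"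
  shows "p = q"
proof (rule ccontr)
  assume "p \<noteq> q"
  moreover have "pt_collinear L q p" using subsetD[OF sub, of p] p by (simp add: mem_orth_iff)
  ultimately obtain l where l: "l \<in> L" "q \<in> l" "p \<in> l" by (metis pt_collinearE)
  obtain w where w: "w \<in> P" "\<not> pt_collinear L p w" using nondegenerate[OF p] by blast
  obtain m where m: "m \<in> l" "m \<in> {w}\<^sup>\<bottom>" using line_meets_orth[OF w(1) l(1)] .
  have mP: "m \<in> P" and pm: "pt_collinear L p m"
    using m l line_subset by (auto intro: pt_collinearI)
  have "{p}\<^sup>\<bottom> \<inter> {q}\<^sup>\<bottom> \<subseteq> {m}\<^sup>\<bottom>"
    using collinear_on_line[OF _ l(1) l(3,2) \<open>p \<noteq> q\<close> _ _ m(1)]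
    by (auto simp: mem_orth_iff pt_collinear_commute)
  then have sub_m: "{p}\<^sup>\<bottom> \<subseteq> {m}\<^sup>\<bottom>" using sub by blast
  have "w \<noteq> m" using w pm by auto
  then obtain k where k: "k \<in> L" "w \<in> k" "m \<in> k"
    using m(2) by (auto simp: mem_orth_iff elim: pt_collinearE)
  have "pt_collinear L m v" if v: "v \<in> P" for v
  proof -
    obtain x where x: "x \<in> k" "x \<in> {v}\<^sup>\<bottom>" using line_meets_orth[OF v k(1)] .
    show ?thesis
    proof (cases "x = m")
      case False
      then have "\<not> pt_collinear L p x"
        using collinear_on_line[OF p k(1) x(1) k(3) _ _ pm k(2)] w(2) by blast
      moreover have "x \<in> {m}\<^sup>\<bottom>" using x k by (auto simp: mem_orth_iff intro: pt_collinearI)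
      moreover have "pt_collinear L v x" using x by (simp add: mem_orth_iff)
      ultimately show ?thesis using collinear_if_orth_subset_orth[OF p mP sub_m] by blast
    qed (use x in \<open>simp add: mem_orth_iff pt_collinear_commute\<close>)
  qed
  then show False using nondegenerate[OF mP] by blast
qed

end

locale noncollinear_pair = finite_polar_space P L
  for P :: "'a set" and L :: "'a set set" +
  fixes p q :: 'a
  assumes p_point: "p \<in> P" and q_point: "q \<in> P" and noncollinear: "\<not> pt_collinear L p q"
begin

definition residue :: "'a set" where
  "residue = {p, q}\<^sup>\<bottom>"

abbreviation residue_lines :: "'a set set" where
  "residue_lines \<equiv> lines_within L residue"

lemma mem_residue_iff: "x \<in> residue \<longleftrightarrow> x \<in> {p}\<^sup>\<bottom> \<and> x \<in> {q}\<^sup>\<bottom>"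
  by (auto simp: residue_def mem_orth_iff)

lemma geom_subspace_residue: "geom_subspace P L residue"
  unfolding residue_def using p_point q_point by (simp add: geom_subspace_orth)

lemmas pt_collinear_residue = pt_collinear_lines_within[OF geom_subspace_residue]
lemmas perp_residue = perp_lines_within[OF geom_subspace_residue]
lemmas orth_residue = orth_lines_within[OF geom_subspace_residue]

definition proj :: "'a \<Rightarrow> 'a" where
  "proj x = (SOME y. y \<in> residue \<and> y \<noteq> p \<and> (\<exists>l\<in>L. {p, x, y} \<subseteq> l))"

lemma
  assumes "x \<in> {p}\<^sup>\<bottom>" "x \<noteq> p"
  shows proj_mem_residue: "proj x \<in> residue" and proj_neq: "proj x \<noteq> p"
    and proj_on_line: "\<exists>l\<in>L. {p, x, proj x} \<subseteq> l"
proof -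
  obtain l where l: "l \<in> L" "p \<in> l" "x \<in> l"
    using assms by (auto simp: mem_orth_iff elim: pt_collinearE)
  obtain y where y: "y \<in> l" "y \<in> {q}\<^sup>\<bottom>" using line_meets_orth[OF q_point l(1)] .
  have "y \<in> residue" using y l by (auto simp: mem_residue_iff mem_orth_iff intro: pt_collinearI)
  moreover have "y \<noteq> p" using y noncollinear by (auto simp: mem_orth_iff pt_collinear_commute)
  ultimately have "y \<in> residue \<and> y \<noteq> p \<and> (\<exists>l\<in>L. {p, x, y} \<subseteq> l)" using l y by auto
  then have "proj x \<in> residue \<and> proj x \<noteq> p \<and> (\<exists>l\<in>L. {p, x, proj x} \<subseteq> l)"
    unfolding proj_def by (rule someI)
  then show "proj x \<in> residue" "proj x \<noteq> p" "\<exists>l\<in>L. {p, x, proj x} \<subseteq> l" by simp_all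
qed

lemma proj_mem_subspace_iff:
  assumes "geom_subspace P L S" "p \<in> S" "x \<in> {p}\<^sup>\<bottom>" "x \<noteq> p"
  shows "proj x \<in> S \<longleftrightarrow> x \<in> S"
proof -
  obtain l where "l \<in> L" "p \<in> l" "x \<in> l" "proj x \<in> l" using proj_on_line[OF assms(3,4)] by blast
  then show ?thesis
    using geom_subspaceD[OF assms(1) _ assms(2)] assms(4) proj_neq[OF assms(3,4)] by metis
qed

lemma collinear_proj_iff:
  assumes "r \<in> {p}\<^sup>\<bottom>" "x \<in> {p}\<^sup>\<bottom>" "x \<noteq> p"
  shows "pt_collinear L r (proj x) \<longleftrightarrow> pt_collinear L r x"
proof -
  have "geom_subspace P L ({r}\<^sup>\<bottom>)" "p \<in> {r}\<^sup>\<bottom>"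
    using assms p_point by (auto simp: mem_orth_iff pt_collinear_commute intro: geom_subspace_orth)
  from proj_mem_subspace_iff[OF this assms(2,3)] show ?thesis
    using proj_mem_residue[OF assms(2,3)] assms(2) by (simp add: mem_residue_iff mem_orth_iff)
qed

lemma not_collinear_within_residue:
  assumes x: "x \<in> residue"
  shows "\<exists>y\<in>residue. \<not> pt_collinear L x y"
proof (rule ccontr)
  assume "\<not> ?thesis"
  then have all: "pt_collinear L x y" if "y \<in> residue" for y using that by blast
  have xP: "x \<in> P" "x \<in> {p}\<^sup>\<bottom>" using x by (auto simp: mem_residue_iff mem_orth_iff)
  have "{p}\<^sup>\<bottom> \<subseteq> {x}\<^sup>\<bottom>"
  proof
    fix z assume z: "z \<in> {p}\<^sup>\<bottom>"
    have "pt_collinear L x z"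
    proof (cases "z = p")
      case False
      then show ?thesis using all proj_mem_residue[OF z] collinear_proj_iff[OF xP(2) z] by blast
    qed (use xP in \<open>simp add: mem_orth_iff pt_collinear_commute\<close>)
    then show "z \<in> {x}\<^sup>\<bottom>" using z by (simp add: mem_orth_iff)
  qed
  then have "p = x" by (rule orth_subset_orth_imp_eq[OF p_point xP(1)])
  moreover have "pt_collinear L q x" using x by (simp add: mem_residue_iff mem_orth_iff)
  ultimately show False using noncollinear by (simp add: pt_collinear_commute)
qed

lemma finite_polar_space_residue: "finite_polar_space residue residue_lines"
proof
  show "finite residue" using finite_points by (simp add: residue_def orth_def)
  show "l = m"
    if "l \<in> residue_lines" "m \<in> residue_lines" "x \<noteq> y" "x \<in> l" "y \<in> l" "x \<in> m" "y \<in> m" for l m x y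
    using partial_linear[of l m x y] that by (simp add: lines_within_def)
  show "(\<exists>!y. y \<in> l \<and> pt_collinear residue_lines x y) \<or>
      (\<forall>y\<in>l. pt_collinear residue_lines x y)"
    if x: "x \<in> residue" and l: "l \<in> residue_lines" for x l
  proof -
    have "pt_collinear residue_lines x y \<longleftrightarrow> pt_collinear L x y" if "y \<in> l" for y
      using pt_collinear_residue x l that by (auto simp: lines_within_def)
    then show ?thesis
      using one_or_all[of x l] x l by (auto simp: lines_within_def mem_residue_iff mem_orth_iff)
  qed
  show "\<exists>y\<in>residue. \<not> pt_collinear residue_lines x y" if "x \<in> residue" for x
    using not_collinear_within_residue[OF that] pt_collinear_residue that by blast
qed (use line_card_ge_3 in \<open>auto simp: lines_within_def\<close>)

context
  fixes A :: "'a set"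
  assumes p_mem: "p \<in> A" and A_points: "A \<subseteq> P" and perp_A: "perp L A A"
begin

lemma mem_orth_of_clique: "a \<in> A \<Longrightarrow> a \<in> {p}\<^sup>\<bottom>"
  using p_mem A_points perp_A by (auto simp: perp_def mem_orth_iff)

lemma geom_subspace_span_clique: "geom_subspace P L \<langle>A\<rangle>" and p_mem_span: "p \<in> \<langle>A\<rangle>"
  using geom_subspace_span[OF A_points] subsetD[OF subset_geom_span p_mem] by simp_all

lemma proj_image_subset: "proj ` (A - {p}) \<subseteq> residue \<inter> \<langle>A\<rangle>"
proof (rule image_subsetI)
  fix a assume "a \<in> A - {p}"
  then have a: "a \<in> A" "a \<noteq> p" by simp_all
  then have "a \<in> \<langle>A\<rangle>" by (intro subsetD[OF subset_geom_span])
  then show "proj a \<in> residue \<inter> \<langle>A\<rangle>"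
    using proj_mem_residue proj_mem_subspace_iff[OF geom_subspace_span_clique p_mem_span]
      mem_orth_of_clique a by simp
qed

lemma perp_proj_image: "perp residue_lines (proj ` (A - {p})) (proj ` (A - {p}))"
  using proj_image_subset perp_residue singular_imp_perp[OF sing_span[OF A_points perp_A]]
  by simp

lemma proj_notin_span_proj_image:
  assumes x: "x \<in> {p}\<^sup>\<bottom>" "x \<notin> \<langle>A\<rangle>"
  shows "proj x \<notin> geom_span residue residue_lines (proj ` (A - {p}))"
proof -
  have "x \<noteq> p" using x(2) p_mem_span by blast
  then have "proj x \<notin> \<langle>A\<rangle>"
    using proj_mem_subspace_iff[OF geom_subspace_span_clique p_mem_span x(1)] x(2) by simp
  moreover have "geom_span residue residue_lines (proj ` (A - {p})) \<subseteq> residue \<inter> \<langle>A\<rangle>"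
    by (rule geom_span_minimal[OF proj_image_subset
          geom_subspace_lines_within[OF geom_subspace_residue geom_subspace_span_clique]])
  ultimately show ?thesis by blast
qed

lemma orth_proj_image_subset: "residue \<inter> (proj ` (A - {p}))\<^sup>\<bottom> \<subseteq> A\<^sup>\<bottom>"
proof
  fix r assume r: "r \<in> residue \<inter> (proj ` (A - {p}))\<^sup>\<bottom>"
  then have rp: "r \<in> {p}\<^sup>\<bottom>" by (simp add: mem_residue_iff)
  have "pt_collinear L a r" if a: "a \<in> A" for a
  proof (cases "a = p")
    case False
    then have "pt_collinear L r (proj a)"
      using r a by (simp add: mem_orth_iff pt_collinear_commute[of L r])
    then show ?thesis
      using collinear_proj_iff[OF rp mem_orth_of_clique[OF a] False]
      by (simp add: pt_collinear_commute[of L a])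
  qed (use rp in \<open>simp add: mem_orth_iff\<close>)
  then show "r \<in> A\<^sup>\<bottom>" using rp by (simp add: mem_orth_iff)
qed

end

end

text \<open>Induction on the number of points of \<open>A\<close>, projecting from one of them.\<close>

lemma singular_separation:
  assumes "finite_polar_space P L" "A \<subseteq> P" "perp L A A" "p \<in> P" "p \<notin> geom_span P L A"
  shows "\<exists>r\<in>orth P L A. \<not> pt_collinear L r p"
  using assms
proof (induction "card A" arbitrary: A P L p rule: less_induct)
  case less
  interpret finite_polar_space P L by (rule less.prems(1))
  have finA: "finite A" using less.prems(2) finite_points finite_subset by blast
  consider (empty) "A = {}" | (not_perp) a where "a \<in> A" "\<not> pt_collinear L a p"
    | (perp) y where "y \<in> A" "p \<in> orth P L A"
    using less.prems(4) by (auto simp: mem_orth_iff)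
  then show ?case
  proof cases
    case empty
    then show ?thesis
      using nondegenerate[OF less.prems(4)] by (auto simp: mem_orth_iff pt_collinear_commute)
  next
    case not_perp
    then show ?thesis using less.prems(2,3) by (auto simp: perp_iff_subset_orth)
  next
    case (perp y)
    have yP: "y \<in> P" using perp less.prems(2) by blast
    then obtain w where w: "w \<in> P" "\<not> pt_collinear L y w" using nondegenerate by blast
    interpret noncollinear_pair P L y w by unfold_locales fact+
    note clique = perp(1) less.prems(2,3)
    have py: "p \<in> orth P L {y}" "p \<noteq> y"
      using perp less.prems(5) p_mem_span[OF clique] by (auto simp: mem_orth_iff)
    have proj_A: "proj ` (A - {y}) \<subseteq> residue" using proj_image_subset[OF clique] by blast
    have "card (proj ` (A - {y})) \<le> card (A - {y})" using finA by (intro card_image_le) simp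
    also have "\<dots> < card A" by (rule card_Diff1_less[OF finA perp(1)])
    finally have "\<exists>r\<in>orth residue residue_lines (proj ` (A - {y})).
        \<not> pt_collinear residue_lines r (proj p)"
      by (intro less.hyps finite_polar_space_residue proj_A perp_proj_image[OF clique]
          proj_mem_residue py proj_notin_span_proj_image[OF clique py(1) less.prems(5)])
    then obtain r where r: "r \<in> residue" "r \<in> orth P L (proj ` (A - {y}))"
      and "\<not> pt_collinear residue_lines r (proj p)"
      unfolding orth_residue[OF proj_A] by blast
    then have "\<not> pt_collinear L r p"
      using pt_collinear_residue[OF r(1) proj_mem_residue[OF py]] collinear_proj_iff[OF _ py]
      by (simp add: mem_residue_iff)
    then show ?thesis using orth_proj_image_subset[OF clique] r by blast
  qed
qed

context finite_polar_space
begin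

text \<open>
  A point of the left-hand side outside \<open>X\<close> could be separated from \<open>X\<close> within the polar space
  \<open>{p, z}\<^sup>\<bottom>\<close>, by a point that is collinear with \<open>p\<close> and \<open>X\<close> and hence with their whole span.
\<close>

lemma span_insert_Int_orth:
  assumes X: "sing X" and p: "p \<in> X\<^sup>\<bottom>" and z: "z \<in> X\<^sup>\<bottom>" "\<not> pt_collinear L p z"
  shows "\<langle>insert p X\<rangle> \<inter> {z}\<^sup>\<bottom> = X"
proof (intro equalityI subsetI)
  have XP: "X \<subseteq> P" by (rule singular_subset_points[OF X])
  then show "x \<in> \<langle>insert p X\<rangle> \<inter> {z}\<^sup>\<bottom>" if "x \<in> X" for x
    using that z subset_geom_span[of "insert p X" P L]
    by (auto simp: mem_orth_iff pt_collinear_commute)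
  interpret noncollinear_pair P L p z by unfold_locales (use p z in \<open>auto simp: mem_orth_iff\<close>)
  have S: "sing \<langle>insert p X\<rangle>" by (rule sing_span_insert[OF X p])
  fix e assume e: "e \<in> \<langle>insert p X\<rangle> \<inter> {z}\<^sup>\<bottom>"
  have XR: "X \<subseteq> residue"
    using XP p z by (auto simp: mem_residue_iff mem_orth_iff pt_collinear_commute)
  have "e \<in> {p}\<^sup>\<bottom>"
    using singular_subset_orth[OF S, of "{p}"] subset_geom_span[of "insert p X" P L] e by blast
  then have eR: "e \<in> residue" using e by (simp add: mem_residue_iff)
  show "e \<in> X"
  proof (rule ccontr)
    assume "e \<notin> X"
    moreover have "geom_subspace residue residue_lines (residue \<inter> X)"
      using geom_subspace_lines_within[OF geom_subspace_residue singular_imp_geom_subspace[OF X]] .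
    then have "geom_span residue residue_lines X = X"
      using XR by (simp add: geom_span_eq Int_absorb1)
    moreover have "perp residue_lines X X"
      using X XR perp_residue by (simp add: singular_subspace_def)
    ultimately have "\<exists>r\<in>orth residue residue_lines X. \<not> pt_collinear residue_lines r e"
      using singular_separation[OF finite_polar_space_residue XR _ eR] by simp
    then obtain r where r: "r \<in> residue" "r \<in> X\<^sup>\<bottom>" "\<not> pt_collinear L r e"
      using pt_collinear_residue[OF _ eR] by (auto simp: orth_residue[OF XR])
    then have "r \<in> (insert p X)\<^sup>\<bottom>" by (auto simp: mem_residue_iff mem_orth_iff)
    then have "r \<in> \<langle>insert p X\<rangle>\<^sup>\<bottom>" using XP p by (simp add: orth_span mem_orth_iff)
    then show False using e r(3) by (auto simp: mem_orth_iff pt_collinear_commute)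
  qed
qed

lemma line_in_cone_meets_base:
  assumes X: "sing X" and p: "p \<in> X\<^sup>\<bottom>" "p \<notin> X" and l: "l \<in> L" "p \<in> l" "l \<subseteq> \<langle>insert p X\<rangle>"
  shows "l \<inter> X \<noteq> {}"
proof -
  have "p \<notin> \<langle>X\<rangle>" using p(2) geom_span_eq[OF singular_imp_geom_subspace[OF X]] by simp
  then have "\<exists>z\<in>X\<^sup>\<bottom>. \<not> pt_collinear L z p"
    using singular_separation[OF finite_polar_space_axioms singular_subset_points[OF X]] X p(1)
    by (simp add: mem_orth_iff singular_subspace_def)
  then obtain z where z: "z \<in> X\<^sup>\<bottom>" "\<not> pt_collinear L p z" by (auto simp: pt_collinear_commute)
  then obtain x where "x \<in> l" "x \<in> {z}\<^sup>\<bottom>" using line_meets_orth l(1) by (auto simp: mem_orth_iff)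
  then show ?thesis using span_insert_Int_orth[OF X p(1) z] l(3) by blast
qed

end

subsection \<open>The rank of a singular subspace\<close>

primrec qnum :: "nat \<Rightarrow> nat \<Rightarrow> nat" where
  "qnum q 0 = 0"
| "qnum q (Suc k) = Suc (q * qnum q k)"

lemma strict_mono_qnum:
  assumes "0 < q" shows "strict_mono (qnum q)"
  unfolding strict_mono_Suc_iff using assms by (simp add: less_Suc_eq_le)

lemma qnum_add: "qnum q (k + m) = qnum q k + q ^ k * qnum q m"
  by (induction k) (auto simp: algebra_simps)

lemma card_eq_mult_card_fibres:
  assumes "finite A" "finite B" "g ` A \<subseteq> B"
    and "\<And>b. b \<in> B \<Longrightarrow> card {a \<in> A. g a = b} = k"
  shows "card A = k * card B"
  using sum.group[OF assms(1-3), of "\<lambda>_. 1 :: nat"] assms(4) by (simp add: mult.commute)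

locale uniform_polar_space = finite_polar_space P L
  for P :: "'a set" and L :: "'a set set" +
  fixes s :: nat
  assumes s_gt_1: "1 < s" and card_line: "l \<in> L \<Longrightarrow> card l = Suc s"
begin

lemma s_pos [simp]: "0 < s" and s_nonzero [simp]: "s \<noteq> 0"
  using s_gt_1 by simp_all

lemma qnum_less_iff [simp]: "qnum s k < qnum s m \<longleftrightarrow> k < m"
  and qnum_le_iff [simp]: "qnum s k \<le> qnum s m \<longleftrightarrow> k \<le> m"
  and qnum_eq_iff [simp]: "qnum s k = qnum s m \<longleftrightarrow> k = m"
  using strict_mono_qnum[OF s_pos]
  by (simp_all add: strict_mono_less strict_mono_less_eq strict_mono_eq)

lemma card_cone:
  assumes S: "sing S" and H: "sing H" "H \<subseteq> S" and p: "p \<in> S" "p \<notin> H"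
    and meet: "\<And>l. \<lbrakk>l \<in> L; p \<in> l; l \<subseteq> S\<rbrakk> \<Longrightarrow> l \<inter> H \<noteq> {}"
  shows "card S = Suc (s * card H)"
proof -
  have "\<exists>x. x \<in> H \<and> (\<exists>l\<in>L. {p, q, x} \<subseteq> l)" if q: "q \<in> S - {p}" for q
  proof -
    obtain l where l: "l \<in> L" "p \<in> l" "q \<in> l" "l \<subseteq> S"
      using singular_lineE[OF S p(1), of q] q by blast
    then show ?thesis using meet[of l] by blast
  qed
  then obtain g where g: "\<And>q. q \<in> S - {p} \<Longrightarrow> g q \<in> H \<and> (\<exists>l\<in>L. {p, q, g q} \<subseteq> l)" by metis
  have "card (S - {p}) = s * card H"
  proof (rule card_eq_mult_card_fibres[where g = g])
    fix x assume x: "x \<in> H"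
    obtain l where l: "l \<in> L" "p \<in> l" "x \<in> l" "l \<subseteq> S"
      using singular_lineE[OF S p(1), of x] x H(2) p(2) by blast
    have "{q \<in> S - {p}. g q = x} = l - {p}"
    proof (intro equalityI subsetI)
      fix q assume q: "q \<in> {q \<in> S - {p}. g q = x}"
      then obtain m where m: "m \<in> L" "p \<in> m" "q \<in> m" "x \<in> m" using g by auto
      then have "m = l" using partial_linear[of m l p x] l x p by blast
      then show "q \<in> l - {p}" using m q by blast
    next
      fix q assume q: "q \<in> l - {p}"
      then have "q \<in> S - {p}" using l by blast
      then obtain m where m: "m \<in> L" "p \<in> m" "q \<in> m" "g q \<in> m" and gq: "g q \<in> H" using g by auto
      then have "m = l" using partial_linear[of m l p q] l q by blast
      then have "g q = x"
        using geom_subspaceD[OF singular_imp_geom_subspace[OF H(1)] l(1) gq x _ _ l(3,2)] m p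
        by blast
      then show "q \<in> {q \<in> S - {p}. g q = x}" using \<open>q \<in> S - {p}\<close> by blast
    qed
    then show "card {q \<in> S - {p}. g q = x} = s"
      using card_line[OF l(1)] l(2) by (simp add: card_Diff_singleton)
  qed (use g finite_sing S H in auto)
  then show ?thesis using card.remove[OF finite_sing[OF S] p(1)] by simp
qed

lemma card_span_insert:
  assumes "sing X" "p \<in> X\<^sup>\<bottom>" "p \<notin> X"
  shows "card \<langle>insert p X\<rangle> = Suc (s * card X)"
proof (rule card_cone)
  show "sing \<langle>insert p X\<rangle>" by (rule sing_span_insert[OF assms(1,2)])
  show "X \<subseteq> \<langle>insert p X\<rangle>" "p \<in> \<langle>insert p X\<rangle>" using subset_geom_span[of "insert p X"] by auto
qed (use assms line_in_cone_meets_base in auto)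

lemma span_basis:
  assumes "finite A" "A \<subseteq> P" "perp L A A"
  shows "\<exists>B\<subseteq>A. \<langle>B\<rangle> = \<langle>A\<rangle> \<and> card \<langle>A\<rangle> = qnum s (card B)"
  using assms
proof (induction A rule: finite_induct)
  case empty
  have "\<langle>{}\<rangle> = {}" by (simp add: geom_span_eq singular_imp_geom_subspace singular_empty)
  then show ?case by simp
next
  case (insert a A)
  have A: "A \<subseteq> P" "a \<in> A\<^sup>\<bottom>" "perp L A A"
    using insert.prems perp_subset[OF insert.prems(2)] by (auto simp: mem_orth_iff perp_def)
  then obtain B where B: "B \<subseteq> A" "\<langle>B\<rangle> = \<langle>A\<rangle>" "card \<langle>A\<rangle> = qnum s (card B)"
    using insert.IH by blast
  show ?case
  proof (cases "a \<in> \<langle>A\<rangle>")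
    case True
    then have "\<langle>insert a A\<rangle> = \<langle>A\<rangle>" by (rule geom_span_redundant)
    then show ?thesis using B by auto
  next
    case False
    have span: "\<langle>insert a A\<rangle> = \<langle>insert a \<langle>A\<rangle>\<rangle>" "\<langle>insert a B\<rangle> = \<langle>insert a \<langle>A\<rangle>\<rangle>"
      using geom_span_insert_span[of P L a A] geom_span_insert_span[of P L a B] B by simp_all
    have "card \<langle>insert a A\<rangle> = Suc (s * card \<langle>A\<rangle>)"
      unfolding span(1) using A False by (intro card_span_insert sing_span) (auto simp: orth_span)
    also have "\<dots> = qnum s (card (insert a B))"
      using B insert.hyps finite_subset[OF B(1)] by (subst card_insert_disjoint) auto
    finally show ?thesis using B(1) span by (intro exI[of _ "insert a B"]) auto
  qed
qed

definition rk :: "'a set \<Rightarrow> nat" where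
  "rk X = nat (proj_dim P L X + 1)"

lemma proj_dim_eq_rk: "proj_dim P L X = int (rk X) - 1"
  by (simp add: rk_def proj_dim_def)

lemma card_sing:
  assumes "sing X" shows "card X = qnum s (rk X)"
proof -
  have X: "X \<subseteq> P" "perp L X X" "\<langle>X\<rangle> = X"
    using singular_subset_points[OF assms] assms
    by (simp_all add: singular_subspace_def geom_span_eq)
  obtain B where B: "B \<subseteq> X" "\<langle>B\<rangle> = X" "card X = qnum s (card B)"
    using span_basis[OF finite_sing[OF assms] X(1,2)] X(3) by auto
  have "(LEAST k. \<exists>A\<subseteq>X. finite A \<and> card A = k \<and> \<langle>A\<rangle> = X) = card B"
  proof (rule Least_equality)
    show "\<exists>A\<subseteq>X. finite A \<and> card A = card B \<and> \<langle>A\<rangle> = X"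
      using B finite_subset[OF B(1) finite_sing[OF assms]] by blast
    fix k assume "\<exists>A\<subseteq>X. finite A \<and> card A = k \<and> \<langle>A\<rangle> = X"
    then obtain A where A: "A \<subseteq> X" "finite A" "card A = k" "\<langle>A\<rangle> = X" by blast
    then obtain C where C: "C \<subseteq> A" "card X = qnum s (card C)"
      using span_basis[of A] X(1) perp_subset[OF X(2)] by blast
    then have "card B = card C" using B(3) by simp
    then show "card B \<le> k" using card_mono[OF A(2) C(1)] A(3) by simp
  qed
  then show ?thesis using B(3) by (simp add: rk_def proj_dim_def)
qed

lemma rk_mono: "\<lbrakk>sing X; sing Y; X \<subseteq> Y\<rbrakk> \<Longrightarrow> rk X \<le> rk Y"
  using card_mono[OF finite_sing, of Y X] by (simp add: card_sing)

lemma rk_subset_eq: "\<lbrakk>sing X; sing Y; X \<subseteq> Y; rk Y \<le> rk X\<rbrakk> \<Longrightarrow> X = Y"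
  using card_seteq[OF finite_sing, of Y X] by (simp add: card_sing)

lemma rk_empty [simp]: "rk {} = 0"
  using card_sing[OF singular_empty] by (cases "rk {}") auto

lemma rk_span_insert: "\<lbrakk>sing X; p \<in> X\<^sup>\<bottom>; p \<notin> X\<rbrakk> \<Longrightarrow> rk \<langle>insert p X\<rangle> = Suc (rk X)"
  using card_span_insert card_sing sing_span_insert qnum_eq_iff qnum.simps(2) by metis

lemma rk_span_insert_le:
  assumes "sing X" "p \<in> X\<^sup>\<bottom>" shows "rk \<langle>insert p X\<rangle> \<le> Suc (rk X)"
proof (cases "p \<in> X")
  case True
  then show ?thesis
    using geom_span_eq[OF singular_imp_geom_subspace[OF assms(1)]] by (simp add: insert_absorb)
qed (simp add: assms rk_span_insert)

lemma rk_cone: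
  assumes "sing S" "sing H" "H \<subseteq> S" "p \<in> S" "p \<notin> H"
    and "\<And>l. \<lbrakk>l \<in> L; p \<in> l; l \<subseteq> S\<rbrakk> \<Longrightarrow> l \<inter> H \<noteq> {}"
  shows "rk S = Suc (rk H)"
proof -
  have "qnum s (rk S) = qnum s (Suc (rk H))"
    using card_cone[OF assms] assms(1,2) by (simp add: card_sing)
  then show ?thesis by (simp only: qnum_eq_iff)
qed

lemma card_Diff_sing:
  assumes "sing X" "sing T" "X \<subseteq> T"
  shows "card (T - X) = s ^ rk X * qnum s (rk T - rk X)"
proof -
  have "card (T - X) = qnum s (rk T) - qnum s (rk X)"
    using assms card_Diff_subset[OF finite_sing[OF assms(1)] assms(3)] by (simp add: card_sing)
  then show ?thesis using qnum_add[of s "rk X" "rk T - rk X"] rk_mono[OF assms] by simp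
qed

definition between :: "'a set \<Rightarrow> 'a set \<Rightarrow> nat \<Rightarrow> 'a set set" where
  "between X Y k = {Z. sing Z \<and> X \<subseteq> Z \<and> Z \<subseteq> Y \<and> rk Z = k}"

abbreviation covers :: "'a set \<Rightarrow> 'a set \<Rightarrow> 'a set set" where
  "covers X Y \<equiv> between X Y (Suc (rk X))"

lemma finite_between: "finite (between X Y k)"
  unfolding between_def by (rule finite_Collect_sing)

lemma span_insert_mem_between:
  assumes X: "sing X" and T: "geom_subspace P L T" "X \<subseteq> T" and p: "p \<in> T" "p \<in> X\<^sup>\<bottom>" "p \<notin> X"
  shows "\<langle>insert p X\<rangle> \<in> covers X T"
proof -
  have "\<langle>insert p X\<rangle> \<subseteq> T" using T p by (intro geom_span_minimal) auto
  then show ?thesis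
    using X p subset_geom_span[of "insert p X" P L]
    by (simp add: between_def sing_span_insert rk_span_insert)
qed

lemma between_nonempty:
  assumes X: "sing X" and Y: "sing Y" and "X \<subseteq> Y" "rk X \<le> k" "k \<le> rk Y"
  shows "between X Y k \<noteq> {}"
  using assms(4,5)
proof (induction k rule: dec_induct)
  case base
  then show ?case using assms by (auto simp: between_def)
next
  case (step k)
  then obtain Z where Z: "sing Z" "X \<subseteq> Z" "Z \<subseteq> Y" "rk Z = k" by (auto simp: between_def)
  then have "Z \<noteq> Y" using step.prems by auto
  then obtain p where p: "p \<in> Y" "p \<notin> Z" using Z(3) by blast
  then have "\<langle>insert p Z\<rangle> \<in> between Z Y (Suc k)"
    using span_insert_mem_between[OF Z(1) singular_imp_geom_subspace[OF Y] Z(3)]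
      singular_subset_orth[OF Y Z(3)] Z(4) by blast
  then show ?case using Z(2) by (auto simp: between_def)
qed

lemma hyperplane_aboveE:
  assumes "sing X" "sing Y" "X \<subset> Y"
  obtains H where "sing H" "X \<subseteq> H" "H \<subseteq> Y" "rk Y = Suc (rk H)"
proof -
  have less: "rk X < rk Y" using assms rk_subset_eq[of X Y] by force
  then obtain H where "H \<in> between X Y (rk Y - 1)"
    using between_nonempty[of X Y "rk Y - 1"] assms by force
  then show thesis using that less by (auto simp: between_def)
qed

lemma span_insert_hyperplane:
  assumes "sing Y" "sing H" "H \<subseteq> Y" "rk Y = Suc (rk H)" "p \<in> Y" "p \<notin> H"
  shows "\<langle>insert p H\<rangle> = Y"
proof (rule rk_subset_eq)
  have p: "p \<in> H\<^sup>\<bottom>" using singular_subset_orth[OF assms(1,3)] assms(5) by blast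
  show "sing \<langle>insert p H\<rangle>" by (rule sing_span_insert[OF assms(2) p])
  show "rk Y \<le> rk \<langle>insert p H\<rangle>" using rk_span_insert[OF assms(2) p assms(6)] assms(4) by simp
  show "\<langle>insert p H\<rangle> \<subseteq> Y" using assms by (intro singular_span_minimal) auto
qed (rule assms(1))

lemma Int_hyperplanes_eq:
  assumes "sing A" "sing B" "sing H" "H \<subseteq> A" "H \<subseteq> B" "rk A = Suc (rk H)" "rk B = Suc (rk H)" "A \<noteq> B"
  shows "A \<inter> B = H"
proof -
  have AB: "sing (A \<inter> B)" by (rule singular_Int[OF assms(1,2)])
  have "\<not> A \<subseteq> B" using assms rk_subset_eq[of A B] by auto
  then have "\<not> rk A \<le> rk (A \<inter> B)" using rk_subset_eq[OF AB assms(1)] by blast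
  then show ?thesis using assms by (intro rk_subset_eq[OF assms(3) AB, symmetric]) auto
qed

subsection \<open>The modular law\<close>

definition join :: "'a set \<Rightarrow> 'a set \<Rightarrow> 'a set" where
  "join X Y = \<langle>X \<union> Y\<rangle>"

lemma join_upper: "X \<subseteq> join X Y" "Y \<subseteq> join X Y"
  using subset_geom_span[of "X \<union> Y"] by (auto simp: join_def)

lemma join_least: "\<lbrakk>sing S; X \<subseteq> S; Y \<subseteq> S\<rbrakk> \<Longrightarrow> join X Y \<subseteq> S"
  by (simp add: join_def singular_span_minimal)

lemma join_span_insert: "join X \<langle>insert p Y\<rangle> = \<langle>insert p (join X Y)\<rangle>"
  unfolding join_def geom_span_eq_hull by (metis Un_insert_right hull_Un_right hull_insert)

lemma sing_join:
  assumes "sing X" "sing Y" "perp L X Y" shows "sing (join X Y)"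
  unfolding join_def
proof (rule sing_span)
  show "X \<union> Y \<subseteq> P" using assms singular_subset_points[of P L] by auto
  show "perp L (X \<union> Y) (X \<union> Y)"
    using assms perp_commute[of L X Y] by (auto simp: singular_subspace_def perp_def)
qed

lemma sing_join_within: "\<lbrakk>sing S; sing X; sing Y; X \<subseteq> S; Y \<subseteq> S\<rbrakk> \<Longrightarrow> sing (join X Y)"
  by (intro sing_join singular_imp_perp)

lemma rk_Int_hyperplane:
  assumes S: "sing S" and H: "sing H" "H \<subseteq> S" "rk S = Suc (rk H)" and Y: "sing Y" "Y \<subseteq> S" "\<not> Y \<subseteq> H"
  shows "rk Y = Suc (rk (Y \<inter> H))"
proof -
  obtain p where p: "p \<in> Y" "p \<notin> H" using Y(3) by blast
  have pS: "p \<in> S" "p \<in> H\<^sup>\<bottom>" using p Y(2) singular_subset_orth[OF S H(2)] by blast+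
  have "\<langle>insert p H\<rangle> = S" by (rule span_insert_hyperplane[OF S H pS(1) p(2)])
  then have "l \<inter> (Y \<inter> H) \<noteq> {}" if "l \<in> L" "p \<in> l" "l \<subseteq> Y" for l
    using line_in_cone_meets_base[OF H(1) pS(2) p(2) that(1,2)] that(3) Y(2) by blast
  then show ?thesis using p by (intro rk_cone[OF Y(1) singular_Int[OF Y(1) H(1)]]) auto
qed

lemma rk_add_le_rk_Int:
  assumes "sing S" "sing X" "sing Y" "X \<subseteq> S" "Y \<subseteq> S"
  shows "rk X + rk Y \<le> rk S + rk (X \<inter> Y)"
  using assms
proof (induction "rk S" arbitrary: S Y rule: less_induct)
  case less
  show ?case
  proof (cases "X = S")
    case False
    then obtain H where H: "sing H" "X \<subseteq> H" "H \<subseteq> S" "rk S = Suc (rk H)"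
      using hyperplane_aboveE[OF less.prems(2,1)] less.prems(4) by blast
    have "rk Y \<le> Suc (rk (Y \<inter> H))"
      using rk_Int_hyperplane[OF less.prems(1) H(1,3,4) less.prems(3,5)]
      by (cases "Y \<subseteq> H") (auto simp: Int_absorb2)
    moreover have "rk X + rk (Y \<inter> H) \<le> rk H + rk (X \<inter> (Y \<inter> H))"
      using H less.prems(2) singular_Int[OF less.prems(3) H(1)] by (intro less.hyps) auto
    moreover have "X \<inter> (Y \<inter> H) = X \<inter> Y" using H(2) by blast
    ultimately show ?thesis using H(4) by simp
  qed (use less.prems(5) in \<open>simp add: Int_absorb1\<close>)
qed

lemma rk_join_add_le:
  assumes "sing S" "sing X" "sing Y" "X \<subseteq> S" "Y \<subseteq> S"
  shows "rk (join X Y) + rk (X \<inter> Y) \<le> rk X + rk Y"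
  using assms
proof (induction "rk Y" arbitrary: Y rule: less_induct)
  case less
  note S = less.prems(1) and X = less.prems(2) and Y = less.prems(3)
  show ?case
  proof (cases "Y \<subseteq> X")
    case True
    then have "join X Y = X" using join_least[OF X, of X Y] join_upper(1)[of X Y] by blast
    then show ?thesis using True by (simp add: Int_absorb1)
  next
    case False
    then have "X \<inter> Y \<subset> Y" by blast
    then obtain H where H: "sing H" "X \<inter> Y \<subseteq> H" "H \<subseteq> Y" "rk Y = Suc (rk H)"
      by (rule hyperplane_aboveE[OF singular_Int[OF X Y] Y])
    then have "\<not> Y \<subseteq> H" using rk_mono[OF Y H(1)] by auto
    then obtain p where p: "p \<in> Y" "p \<notin> H" by blast
    define J where "J = join X H"
    have J: "sing J" "J \<subseteq> S"
      using sing_join_within join_least[OF S] S X H less.prems(4,5) by (auto simp: J_def)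
    have pJ: "p \<in> J\<^sup>\<bottom>" using singular_subset_orth[OF S J(2)] p less.prems(5) by blast
    have "join X Y = \<langle>insert p J\<rangle>"
      unfolding J_def join_span_insert[symmetric] span_insert_hyperplane[OF Y H(1,3,4) p] ..
    then have "rk (join X Y) \<le> Suc (rk J)" using rk_span_insert_le[OF J(1) pJ] by simp
    moreover have "rk J + rk (X \<inter> H) \<le> rk X + rk H"
      unfolding J_def using H less.prems by (intro less.hyps) auto
    moreover have "X \<inter> H = X \<inter> Y" using H by blast
    ultimately show ?thesis using H(4) by simp
  qed
qed

lemma rk_modular:
  assumes "sing X" "sing Y" "perp L X Y"
  shows "rk (join X Y) + rk (X \<inter> Y) = rk X + rk Y"
  using rk_add_le_rk_Int[OF sing_join[OF assms] assms(1,2) join_upper]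
    rk_join_add_le[OF sing_join[OF assms] assms(1,2) join_upper] by (rule antisym[rotated])

subsection \<open>Covers, complements and hyperplanes\<close>

text \<open>\<open>T\<close> need not be singular: \<open>T = X\<^sup>\<bottom>\<close> will count all covers of \<open>X\<close>.\<close>

lemma card_Diff_eq_card_covers:
  assumes X: "sing X" and T: "geom_subspace P L T" "X \<subseteq> T" "T \<subseteq> X\<^sup>\<bottom>"
  shows "card (T - X) = s ^ rk X * card (covers X T)"
proof (rule card_eq_mult_card_fibres[where g = "\<lambda>p. \<langle>insert p X\<rangle>"])
  show "finite (T - X)"
    using finite_subset[OF geom_subspace_subset_points[OF T(1)] finite_points] by simp
  show "(\<lambda>p. \<langle>insert p X\<rangle>) ` (T - X) \<subseteq> covers X T"
    using span_insert_mem_between[OF X T(1,2)] T(3) by blast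
  fix W assume "W \<in> covers X T"
  then have W: "sing W" "X \<subseteq> W" "W \<subseteq> T" "rk W = Suc (rk X)" by (auto simp: between_def)
  have "{p \<in> T - X. \<langle>insert p X\<rangle> = W} = W - X"
    using span_insert_hyperplane[OF W(1) X W(2,4)] W(3) subset_geom_span by fast
  then show "card {p \<in> T - X. \<langle>insert p X\<rangle> = W} = s ^ rk X"
    using card_Diff_sing[OF X W(1,2)] W(4) by simp
qed (rule finite_between)

lemma card_covers_within:
  assumes "sing X" "sing T" "X \<subseteq> T"
  shows "card (covers X T) = qnum s (rk T - rk X)"
proof -
  have "s ^ rk X * card (covers X T) = s ^ rk X * qnum s (rk T - rk X)"
    using card_Diff_eq_card_covers[OF assms(1) singular_imp_geom_subspace assms(3)]
      card_Diff_sing[OF assms] singular_subset_orth[OF assms(2,3)] assms(2) by simp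
  then show ?thesis by simp
qed

lemma card_covers_outside_hyperplane:
  assumes X: "sing X" and H: "sing H" "X \<subseteq> H" and T: "sing T" "H \<subseteq> T" "rk T = Suc (rk H)"
  shows "card (covers X T - covers X H) = s ^ (rk H - rk X)"
proof -
  have "card (covers X T - covers X H)
      = card (covers X T) - card (covers X H)"
    using T(2) by (intro card_Diff_subset finite_between) (auto simp: between_def)
  also have "\<dots> = qnum s (rk H - rk X + 1) - qnum s (rk H - rk X)"
    using card_covers_within[OF X T(1)] card_covers_within[OF X H] H T rk_mono[OF X H]
    by (simp add: Suc_diff_le)
  also have "\<dots> = s ^ (rk H - rk X)" by (simp only: qnum_add) simp
  finally show ?thesis .
qed

definition complements :: "'a set \<Rightarrow> 'a set \<Rightarrow> 'a set \<Rightarrow> 'a set set" where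
  "complements Z X W = {Y. sing Y \<and> Y \<subseteq> W \<and> X \<inter> Y = Z \<and> rk X + rk Y = rk Z + rk W}"

lemma complement_Int_hyperplane:
  assumes X: "sing X" "X \<subseteq> H" and H: "sing H" "H \<subseteq> W" and W: "sing W" "rk W = Suc (rk H)"
    and Y: "Y \<in> complements Z X W"
  shows "Y \<inter> H \<in> complements Z X H"
proof -
  have Y: "sing Y" "Y \<subseteq> W" "X \<inter> Y = Z" "rk X + rk Y = rk Z + rk W"
    using Y by (simp_all add: complements_def)
  have "\<not> Y \<subseteq> H"
  proof
    assume "Y \<subseteq> H"
    then have "rk X + rk Y \<le> rk H + rk Z"
      using rk_add_le_rk_Int[OF H(1) X(1) Y(1) X(2)] Y(3) by simp
    then show False using Y(4) W(2) by simp
  qed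
  then have "rk Y = Suc (rk (Y \<inter> H))"
    by (rule rk_Int_hyperplane[OF W(1) H W(2) Y(1,2)])
  moreover have "X \<inter> (Y \<inter> H) = Z" using Y(3) X(2) by blast
  ultimately show ?thesis
    using Y(4) W(2) singular_Int[OF Y(1) H(1)] by (simp add: complements_def)
qed

lemma complements_over_hyperplane:
  assumes X: "X \<subseteq> H" and H: "sing H" "H \<subseteq> W" and W: "sing W" "rk W = Suc (rk H)"
    and Y': "Y' \<in> complements Z X H"
  shows "{Y \<in> complements Z X W. Y \<inter> H = Y'}
    = covers Y' W - covers Y' H"
proof -
  have Y': "sing Y'" "Y' \<subseteq> H" "X \<inter> Y' = Z" "rk X + rk Y' = rk Z + rk H"
    using Y' by (simp_all add: complements_def)
  show ?thesis
  proof (intro equalityI subsetI)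
    fix Y assume "Y \<in> {Y \<in> complements Z X W. Y \<inter> H = Y'}"
    then have Y: "sing Y" "Y \<subseteq> W" "rk X + rk Y = rk Z + rk W" "Y \<inter> H = Y'"
      by (simp_all add: complements_def)
    have "rk Y = Suc (rk Y')" using Y(3) Y'(4) W(2) by simp
    moreover from this have "\<not> Y \<subseteq> H" using Y(4) by (auto simp: Int_absorb2)
    ultimately show "Y \<in> covers Y' W - covers Y' H"
      using Y(1,2) Y(4)[symmetric] by (simp add: between_def)
  next
    fix Y assume "Y \<in> covers Y' W - covers Y' H"
    then have Y: "sing Y" "Y' \<subseteq> Y" "Y \<subseteq> W" "rk Y = Suc (rk Y')" "\<not> Y \<subseteq> H"
      by (auto simp: between_def)
    have "rk (Y \<inter> H) = rk Y'" using rk_Int_hyperplane[OF W(1) H W(2) Y(1,3,5)] Y(4) by simp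
    then have "Y' = Y \<inter> H"
      using Y(2) Y'(1,2) singular_Int[OF Y(1) H(1)] by (intro rk_subset_eq) auto
    moreover from this have "X \<inter> Y = Z" using X Y'(3) by blast
    ultimately show "Y \<in> {Y \<in> complements Z X W. Y \<inter> H = Y'}"
      using Y(1,3,4) Y'(4) W(2) by (simp add: complements_def)
  qed
qed

lemma card_complements:
  assumes Z: "sing Z" and X: "sing X" "Z \<subseteq> X" and W: "sing W" "X \<subseteq> W"
  shows "card (complements Z X W) = s ^ ((rk X - rk Z) * (rk W - rk X))"
  using W
proof (induction "rk W - rk X" arbitrary: W)
  case 0
  then have "X = W" by (intro rk_subset_eq) (use X in auto)
  then have "complements Z X W = {Z}" using Z X by (auto simp: complements_def)
  then show ?case using 0 by simp
next
  case (Suc m)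
  then have "X \<subset> W" by auto
  then obtain H where H: "sing H" "X \<subseteq> H" "H \<subseteq> W" "rk W = Suc (rk H)"
    by (rule hyperplane_aboveE[OF X(1) Suc.prems(1)])
  have XH: "rk X \<le> rk H" by (rule rk_mono[OF X(1) H(1,2)])
  have "card (complements Z X W) = s ^ (rk X - rk Z) * card (complements Z X H)"
  proof (rule card_eq_mult_card_fibres[where g = "\<lambda>Y. Y \<inter> H"])
    show "finite (complements Z X W)" "finite (complements Z X H)"
      by (simp_all add: complements_def finite_Collect_sing)
    show "(\<lambda>Y. Y \<inter> H) ` complements Z X W \<subseteq> complements Z X H"
      using complement_Int_hyperplane[OF X(1) H(2,1,3) Suc.prems(1) H(4)] by blast
    fix Y' assume Y': "Y' \<in> complements Z X H"
    then have "sing Y'" "Y' \<subseteq> H" "rk X + rk Y' = rk Z + rk H" by (simp_all add: complements_def)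
    moreover from this have "rk H - rk Y' = rk X - rk Z"
      using rk_mono[OF Z X] XH by linarith
    ultimately show "card {Y \<in> complements Z X W. Y \<inter> H = Y'} = s ^ (rk X - rk Z)"
      unfolding complements_over_hyperplane[OF H(2,1,3) Suc.prems(1) H(4) Y']
      using card_covers_outside_hyperplane[OF _ H(1) _ Suc.prems(1) H(3,4)] by simp
  qed
  also have "card (complements Z X H) = s ^ ((rk X - rk Z) * m)"
  proof -
    have "m = rk H - rk X" using Suc.hyps(2) H(4) XH by linarith
    then show ?thesis using Suc.hyps(1)[OF _ H(1,2)] by simp
  qed
  finally show ?case unfolding Suc.hyps(2)[symmetric] by (simp add: power_add)
qed

lemma hyperplanes_not_above_eq_complements:
  assumes X: "sing X" and T: "sing T" "rk T = Suc k" and A: "A \<in> covers X T"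
  shows "{H \<in> between X T k. \<not> A \<subseteq> H} = complements X A T"
proof -
  have A: "sing A" "X \<subseteq> A" "A \<subseteq> T" "rk A = Suc (rk X)" using A by (auto simp: between_def)
  show ?thesis
  proof (intro equalityI subsetI)
    fix H assume "H \<in> {H \<in> between X T k. \<not> A \<subseteq> H}"
    then have H: "sing H" "X \<subseteq> H" "H \<subseteq> T" "rk H = k" "\<not> A \<subseteq> H" by (auto simp: between_def)
    have "rk A = Suc (rk (A \<inter> H))" using H A T(2) by (intro rk_Int_hyperplane[OF T(1) H(1,3)]) auto
    then have "X = A \<inter> H"
      using A H X singular_Int[OF A(1) H(1)] by (intro rk_subset_eq) auto
    then show "H \<in> complements X A T" using H A T(2) by (simp add: complements_def)
  next
    fix H assume "H \<in> complements X A T"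
    then have "sing H" "H \<subseteq> T" "A \<inter> H = X" "rk H = k"
      using A(4) T(2) by (auto simp: complements_def)
    moreover have "A \<noteq> X" using A(4) by auto
    ultimately show "H \<in> {H \<in> between X T k. \<not> A \<subseteq> H}" by (auto simp: between_def)
  qed
qed

text \<open>Double counting of the pairs of a cover \<open>A\<close> of \<open>X\<close> and a hyperplane not above \<open>A\<close>.\<close>

lemma card_hyperplanes_above:
  assumes X: "sing X" and T: "sing T" "X \<subseteq> T" and k: "rk T = Suc k"
  shows "card (between X T k) = qnum s (rk T - rk X)"
proof (cases "X = T")
  case True
  then have "between X T k = {}" using k by (auto simp: between_def)
  then show ?thesis using True by simp
next
  case False
  let ?A = "covers X T"
  have "(\<Sum>A\<in>?A. card {H \<in> between X T k. \<not> A \<subseteq> H}) = s ^ (k - rk X) * card (between X T k)"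
  proof (intro sum_multicount finite_between ballI)
    fix H assume "H \<in> between X T k"
    then have H: "sing H" "X \<subseteq> H" "H \<subseteq> T" "rk H = k" by (auto simp: between_def)
    have "{A \<in> ?A. \<not> A \<subseteq> H} = ?A - covers X H" by (auto simp: between_def)
    then show "card {A \<in> ?A. \<not> A \<subseteq> H} = s ^ (k - rk X)"
      using card_covers_outside_hyperplane[OF X H(1,2) T(1) H(3)] H(4) k by simp
  qed
  moreover have "card {H \<in> between X T k. \<not> A \<subseteq> H} = s ^ (k - rk X)" if A: "A \<in> ?A" for A
  proof -
    have "sing A" "X \<subseteq> A" "A \<subseteq> T" "rk A = Suc (rk X)" using A by (auto simp: between_def)
    then show ?thesis
      unfolding hyperplanes_not_above_eq_complements[OF X T(1) k A]
      using card_complements[OF X, of A T] T(1) k by simp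
  qed
  ultimately have "card ?A = card (between X T k)" by simp
  then show ?thesis using card_covers_within[OF X T] by simp
qed

lemma card_between_Suc:
  assumes "\<And>Z. Z \<in> between A B k \<Longrightarrow> card (between Z B (Suc k)) = up"
    and "\<And>W. W \<in> between A B (Suc k) \<Longrightarrow> card (between A W k) = down"
  shows "down * card (between A B (Suc k)) = up * card (between A B k)"
proof -
  have "{W \<in> between A B (Suc k). Z \<subseteq> W} = between Z B (Suc k)" if "Z \<in> between A B k" for Z
    using that by (auto simp: between_def)
  then have "(\<Sum>Z\<in>between A B k. card {W \<in> between A B (Suc k). Z \<subseteq> W}) = up * card (between A B k)"
    using assms(1) by simp
  moreover have "{Z \<in> between A B k. Z \<subseteq> W} = between A W k" if "W \<in> between A B (Suc k)" for W
    using that by (auto simp: between_def)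
  then have "(\<Sum>Z\<in>between A B k. card {W \<in> between A B (Suc k). Z \<subseteq> W})
      = down * card (between A B (Suc k))"
    using assms(2) by (intro sum_multicount finite_between) simp
  ultimately show ?thesis by simp
qed

end

subsection \<open>Polar spaces of order \<open>(s, \<dots>, s, t)\<close>\<close>

locale polar_space_of_order = finite_polar_space P L
  for P :: "'a set" and L :: "'a set set" +
  fixes n s t :: nat
  assumes polar_rank: "has_polar_rank P L n" and polar_order: "has_polar_order P L n s t"

sublocale polar_space_of_order \<subseteq> uniform_polar_space P L s
  by unfold_locales (use polar_order in \<open>auto simp: has_polar_order_def\<close>)

context polar_space_of_order
begin

lemma t_pos: "0 < t"
  using polar_order by (simp add: has_polar_order_def)

lemma rk_maximal: "maximal_singular P L M \<Longrightarrow> rk M = n"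
  using polar_rank proj_dim_eq_rk[of M] by (simp add: has_polar_rank_def)

lemma maximal_aboveE:
  assumes "sing X" obtains M where "sing M" "rk M = n" "X \<subseteq> M"
proof -
  obtain M where "sing M" "X \<subseteq> M" "\<forall>Y. sing Y \<longrightarrow> M \<subseteq> Y \<longrightarrow> M = Y"
    using finite_has_maximal2[OF finite_Collect_sing[of "\<lambda>_. True"], of X] assms by auto
  moreover from this have "maximal_singular P L M" by (auto simp: maximal_singular_def)
  ultimately show thesis by (intro that rk_maximal)
qed

lemma rk_le_n: "sing X \<Longrightarrow> rk X \<le> n"
  by (metis maximal_aboveE rk_mono)

lemma maximal_singular_iff: "maximal_singular P L M \<longleftrightarrow> sing M \<and> rk M = n"
proof
  assume M: "sing M \<and> rk M = n"
  then have "X = M" if "sing X" "M \<subseteq> X" for X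
    using rk_subset_eq[of M X] rk_le_n[OF that(1)] that by simp
  then show "maximal_singular P L M" using M by (simp add: maximal_singular_def)
qed (auto simp: maximal_singular_def rk_maximal)

lemma card_maximal_above:
  assumes "sing U" "Suc (rk U) = n"
  shows "card {M. sing M \<and> rk M = n \<and> U \<subseteq> M} = t + 1"
proof -
  have "proj_dim P L U = int n - 2" using assms(2) proj_dim_eq_rk[of U] by simp
  then have "card {M. maximal_singular P L M \<and> U \<subseteq> M} = t + 1"
    using polar_order assms(1) by (simp add: has_polar_order_def)
  then show ?thesis by (simp add: maximal_singular_iff conj_assoc)
qed

lemma
  assumes M: "sing M" "rk M = n" and p: "p \<in> P" "p \<notin> M"
  shows sing_maximal_Int_orth: "sing (M \<inter> {p}\<^sup>\<bottom>)"
    and rk_maximal_Int_orth: "Suc (rk (M \<inter> {p}\<^sup>\<bottom>)) = n"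
proof -
  have "geom_subspace P L (M \<inter> {p}\<^sup>\<bottom>)"
    using p by (intro geom_subspace_Int singular_imp_geom_subspace M geom_subspace_orth) simp
  then show H: "sing (M \<inter> {p}\<^sup>\<bottom>)"
    by (simp add: singular_subspace_def singular_imp_perp[OF M(1)])
  have "p \<notin> M\<^sup>\<bottom>"
  proof
    assume pM: "p \<in> M\<^sup>\<bottom>"
    then show False
      using rk_span_insert[OF M(1) pM p(2)] rk_le_n[OF sing_span_insert[OF M(1) pM]] M(2) by simp
  qed
  then obtain m where m: "m \<in> M" "m \<notin> M \<inter> {p}\<^sup>\<bottom>"
    using p by (auto simp: mem_orth_iff pt_collinear_commute)
  have "rk M = Suc (rk (M \<inter> {p}\<^sup>\<bottom>))"
  proof (rule rk_cone[OF M(1) H _ m])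
    fix l assume "l \<in> L" "l \<subseteq> M"
    then show "l \<inter> (M \<inter> {p}\<^sup>\<bottom>) \<noteq> {}" using line_meets_orth[OF p(1)] by blast
  qed simp
  then show "Suc (rk (M \<inter> {p}\<^sup>\<bottom>)) = n" using M(2) by simp
qed

definition adjacent_maximals :: "'a set \<Rightarrow> 'a set \<Rightarrow> 'a set set" where
  "adjacent_maximals X M = {M'. sing M' \<and> rk M' = n \<and> X \<subseteq> M' \<and> Suc (rk (M \<inter> M')) = n}"

lemma finite_adjacent_maximals: "finite (adjacent_maximals X M)"
  unfolding adjacent_maximals_def by (rule finite_Collect_sing)

lemma Int_adjacent_maximal:
  assumes M: "sing M" "rk M = n" and p: "p \<in> P" "p \<notin> M" and M': "M' \<in> adjacent_maximals {p} M"
  shows "M \<inter> M' = M \<inter> {p}\<^sup>\<bottom>"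
proof (rule rk_subset_eq)
  have M': "sing M'" "p \<in> M'" "Suc (rk (M \<inter> M')) = n"
    using M' by (simp_all add: adjacent_maximals_def)
  show "M \<inter> M' \<subseteq> M \<inter> {p}\<^sup>\<bottom>" using singular_subset_orth[OF M'(1), of "{p}"] M'(2) by blast
  show "rk (M \<inter> {p}\<^sup>\<bottom>) \<le> rk (M \<inter> M')" using rk_maximal_Int_orth[OF M p] M'(3) by simp
  show "sing (M \<inter> M')" by (rule singular_Int[OF M(1) M'(1)])
qed (rule sing_maximal_Int_orth[OF M p])

lemma ex1_adjacent_maximal:
  assumes M: "sing M" "rk M = n" and p: "p \<in> P" "p \<notin> M"
  shows "\<exists>!M'. M' \<in> adjacent_maximals {p} M"
proof (rule ex1I)
  let ?H = "M \<inter> {p}\<^sup>\<bottom>"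
  let ?M' = "\<langle>insert p ?H\<rangle>"
  note H = sing_maximal_Int_orth[OF M p] rk_maximal_Int_orth[OF M p]
  have pH: "p \<in> ?H\<^sup>\<bottom>" "p \<notin> ?H" using p by (auto simp: mem_orth_iff pt_collinear_commute)
  have M': "sing ?M'" "rk ?M' = n" "p \<in> ?M'" "?H \<subseteq> ?M'"
    using sing_span_insert[OF H(1) pH(1)] rk_span_insert[OF H(1) pH] H(2)
      subset_geom_span[of "insert p ?H" P L] by auto
  then have "M \<inter> ?M' = ?H" using M p H by (intro Int_hyperplanes_eq) auto
  then show "?M' \<in> adjacent_maximals {p} M" using M' H(2) by (simp add: adjacent_maximals_def)
  fix M'' assume M'': "M'' \<in> adjacent_maximals {p} M"
  then have "?H \<subseteq> M''" using Int_adjacent_maximal[OF M p M''] by blast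
  then show "M'' = ?M'"
    using span_insert_hyperplane[OF _ H(1), of M'' p] M'' H(2) p(2)
    by (simp add: adjacent_maximals_def)
qed

lemma card_adjacent_maximals:
  assumes n: "0 < n" and X: "sing X" and M: "sing M" "rk M = n" "X \<subseteq> M"
  shows "card (adjacent_maximals X M) = t * qnum s (n - rk X)"
proof -
  have "card (adjacent_maximals X M) = t * card (between X M (n - 1))"
  proof (rule card_eq_mult_card_fibres[where g = "\<lambda>M'. M \<inter> M'"])
    show "(\<lambda>M'. M \<inter> M') ` adjacent_maximals X M \<subseteq> between X M (n - 1)"
    proof clarify
      fix M' assume "M' \<in> adjacent_maximals X M"
      then have M': "sing M'" "X \<subseteq> M'" "Suc (rk (M \<inter> M')) = n"
        by (simp_all add: adjacent_maximals_def)
      then show "M \<inter> M' \<in> between X M (n - 1)"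
        using M(3) singular_Int[OF M(1) M'(1)] by (simp add: between_def)
    qed
    fix H assume "H \<in> between X M (n - 1)"
    then have H: "sing H" "X \<subseteq> H" "H \<subseteq> M" "Suc (rk H) = n" using n by (auto simp: between_def)
    have "{M' \<in> adjacent_maximals X M. M \<inter> M' = H} = {M'. sing M' \<and> rk M' = n \<and> H \<subseteq> M'} - {M}"
    proof (intro equalityI subsetI)
      fix M' assume "M' \<in> {M' \<in> adjacent_maximals X M. M \<inter> M' = H}"
      then have M': "sing M'" "rk M' = n" "M \<inter> M' = H" by (simp_all add: adjacent_maximals_def)
      moreover from this have "M' \<noteq> M" using H(4) by auto
      ultimately show "M' \<in> {M'. sing M' \<and> rk M' = n \<and> H \<subseteq> M'} - {M}" by blast
    next
      fix M' assume "M' \<in> {M'. sing M' \<and> rk M' = n \<and> H \<subseteq> M'} - {M}"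
      then have M': "sing M'" "rk M' = n" "H \<subseteq> M'" "M \<noteq> M'" by auto
      then have "M \<inter> M' = H" using M(1,2) H by (intro Int_hyperplanes_eq) simp_all
      moreover have "X \<subseteq> M'" using H(2) M'(3) by blast
      ultimately show "M' \<in> {M' \<in> adjacent_maximals X M. M \<inter> M' = H}"
        using M'(1,2) H(4) by (simp add: adjacent_maximals_def)
    qed
    then show "card {M' \<in> adjacent_maximals X M. M \<inter> M' = H} = t"
      using card_maximal_above[OF H(1,4)] M(1,2) H(3) by simp
  qed (rule finite_adjacent_maximals finite_between)+
  then show ?thesis using card_hyperplanes_above[OF X M(1,3)] M(2) n by simp
qed

definition adjacent_maximal_through :: "'a set \<Rightarrow> 'a \<Rightarrow> 'a set" where
  "adjacent_maximal_through M p = (THE M'. M' \<in> adjacent_maximals {p} M)"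

lemma adjacent_maximal_through_eq_iff:
  assumes "sing M" "rk M = n" "p \<in> P" "p \<notin> M"
  shows "adjacent_maximal_through M p = M' \<longleftrightarrow> M' \<in> adjacent_maximals {p} M"
  unfolding adjacent_maximal_through_def
  using theI'[OF ex1_adjacent_maximal[OF assms]] the1_equality[OF ex1_adjacent_maximal[OF assms]]
  by blast

lemma adjacent_maximal_through_mem:
  assumes X: "sing X" and M: "sing M" "rk M = n" "X \<subseteq> M" and p: "p \<in> X\<^sup>\<bottom>" "p \<notin> M"
  shows "adjacent_maximal_through M p \<in> adjacent_maximals X M"
proof -
  let ?M' = "adjacent_maximal_through M p"
  have pP: "p \<in> P" using p(1) by (simp add: mem_orth_iff)
  have M': "?M' \<in> adjacent_maximals {p} M"
    using adjacent_maximal_through_eq_iff[OF M(1,2) pP p(2)] by blast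
  then have "M \<inter> ?M' = M \<inter> {p}\<^sup>\<bottom>" by (rule Int_adjacent_maximal[OF M(1,2) pP p(2)])
  moreover have "X \<subseteq> {p}\<^sup>\<bottom>"
    using p(1) singular_subset_points[OF X] by (auto simp: mem_orth_iff pt_collinear_commute)
  ultimately have "X \<subseteq> ?M'" using M(3) by blast
  then show ?thesis using M' by (simp add: adjacent_maximals_def)
qed

lemma card_orth_Diff_maximal:
  assumes X: "sing X" and M: "sing M" "rk M = n" "X \<subseteq> M"
  shows "card (X\<^sup>\<bottom> - M) = s ^ (n - 1) * card (adjacent_maximals X M)"
proof (rule card_eq_mult_card_fibres[where g = "adjacent_maximal_through M"])
  show "finite (X\<^sup>\<bottom> - M)" using finite_points by (simp add: orth_def)
  show "adjacent_maximal_through M ` (X\<^sup>\<bottom> - M) \<subseteq> adjacent_maximals X M"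
    using adjacent_maximal_through_mem[OF X M] by blast
  fix M' assume "M' \<in> adjacent_maximals X M"
  then have M': "sing M'" "rk M' = n" "X \<subseteq> M'" "Suc (rk (M \<inter> M')) = n"
    by (simp_all add: adjacent_maximals_def)
  have "adjacent_maximal_through M p = M' \<longleftrightarrow> p \<in> M'" if "p \<in> P" "p \<notin> M" for p
    using adjacent_maximal_through_eq_iff[OF M(1,2) that] M' by (simp add: adjacent_maximals_def)
  moreover have "M' \<subseteq> X\<^sup>\<bottom>" "X\<^sup>\<bottom> \<subseteq> P"
    using singular_subset_orth[OF M'(1,3)] by (auto simp: orth_def)
  ultimately have "{p \<in> X\<^sup>\<bottom> - M. adjacent_maximal_through M p = M'} = M' - M \<inter> M'" by blast
  moreover have "rk (M \<inter> M') = n - 1" "rk M' - rk (M \<inter> M') = Suc 0" using M'(2,4) by auto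
  ultimately show "card {p \<in> X\<^sup>\<bottom> - M. adjacent_maximal_through M p = M'} = s ^ (n - 1)"
    using card_Diff_sing[OF singular_Int[OF M(1) M'(1)] M'(1)] by simp
qed (rule finite_adjacent_maximals)

lemma card_orth:
  assumes n: "0 < n" and X: "sing X"
  shows "card (X\<^sup>\<bottom>) = qnum s n + s ^ (n - 1) * (t * qnum s (n - rk X))"
proof -
  obtain M where M: "sing M" "rk M = n" "X \<subseteq> M" using maximal_aboveE[OF X] .
  have "finite (X\<^sup>\<bottom>)" using finite_points by (simp add: orth_def)
  then have "card (X\<^sup>\<bottom>) = card M + card (X\<^sup>\<bottom> - M)"
    using singular_subset_orth[OF M(1,3)] by (simp add: card_Diff_subset finite_sing M card_mono)
  then show ?thesis
    using card_orth_Diff_maximal[OF X M] card_adjacent_maximals[OF n X M] M(1,2)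
    by (simp add: card_sing)
qed

text \<open>The number of points of a polar space of rank \<open>c\<close> with the same \<open>s\<close> and \<open>t\<close>.\<close>

definition polar_points :: "nat \<Rightarrow> nat" where
  "polar_points c = qnum s c * (t * s ^ (c - 1) + 1)"

lemma card_covers:
  assumes X: "sing X" shows "card (covers X P) = polar_points (n - rk X)"
proof (cases "rk X = n")
  case True
  then have "covers X P = {}" using rk_le_n by (fastforce simp: between_def)
  then show ?thesis using True by (simp add: polar_points_def)
next
  case False
  define m where "m = n - rk X - 1"
  have n: "n = rk X + Suc m" using False rk_le_n[OF X] by (simp add: m_def)
  have "covers X P = covers X (X\<^sup>\<bottom>)"
    using singular_subset_orth[of P L] singular_subset_points[of P L] unfolding between_def by blast
  moreover have "card X + s ^ rk X * card (covers X (X\<^sup>\<bottom>)) = card (X\<^sup>\<bottom>)"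
  proof -
    have XX: "X \<subseteq> X\<^sup>\<bottom>" by (rule singular_subset_orth[OF X order_refl])
    then have "card (X\<^sup>\<bottom> - X) = s ^ rk X * card (covers X (X\<^sup>\<bottom>))"
      by (intro card_Diff_eq_card_covers X geom_subspace_orth singular_subset_points[OF X]) auto
    moreover have "finite (X\<^sup>\<bottom>)" using finite_points by (simp add: orth_def)
    ultimately show ?thesis
      using card_Diff_subset[OF finite_sing[OF X] XX] card_mono[OF _ XX] by simp
  qed
  moreover have "card (X\<^sup>\<bottom>) = card X + s ^ rk X * polar_points (Suc m)"
  proof -
    have "card (X\<^sup>\<bottom>) = qnum s (rk X + Suc m) + s ^ (rk X + m) * (t * qnum s (Suc m))"
      using card_orth[OF _ X] n by (simp del: qnum.simps)
    also have "\<dots> = qnum s (rk X) + s ^ rk X * (qnum s (Suc m) * (t * s ^ m + 1))"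
      unfolding qnum_add by (simp add: power_add algebra_simps del: qnum.simps)
    finally show ?thesis using X by (simp add: card_sing polar_points_def)
  qed
  ultimately show ?thesis using n by simp
qed

subsection \<open>Perpendicular subspaces of equal rank\<close>

definition perp_sphere :: "'a set \<Rightarrow> nat \<Rightarrow> 'a set set" where
  "perp_sphere X r = {Y. sing Y \<and> rk Y = rk X \<and> perp L X Y \<and> rk (X \<inter> Y) + r = rk X}"

lemma finite_perp_sphere: "finite (perp_sphere X r)"
  unfolding perp_sphere_def by (rule finite_Collect_sing)

lemma perp_sphere_0:
  assumes X: "sing X" shows "perp_sphere X 0 = {X}"
proof -
  have "Y = X" if "Y \<in> perp_sphere X 0" for Y
  proof -
    have Y: "sing Y" "rk Y = rk X" "rk (X \<inter> Y) = rk X" using that by (auto simp: perp_sphere_def)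
    then have "X \<inter> Y = X" by (intro rk_subset_eq singular_Int X) auto
    then show ?thesis using Y X by (intro rk_subset_eq[symmetric]) auto
  qed
  then show ?thesis using X singular_imp_perp[OF X] by (auto simp: perp_sphere_def)
qed

lemma rk_join_perp_sphere: "\<lbrakk>sing X; Y \<in> perp_sphere X r\<rbrakk> \<Longrightarrow> rk (join X Y) = rk X + r"
  using rk_modular[of X Y] by (auto simp: perp_sphere_def)

lemma perp_sphere_fibre:
  assumes X: "sing X" and Z: "Z \<in> between {} X k" "k + r = rk X" and W: "W \<in> between X P (rk X + r)"
  shows "{Y \<in> perp_sphere X r. (X \<inter> Y, join X Y) = (Z, W)} = complements Z X W"
proof -
  have Z: "sing Z" "Z \<subseteq> X" "rk Z + r = rk X" and W: "sing W" "X \<subseteq> W" "rk W = rk X + r"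
    using Z W by (auto simp: between_def)
  show ?thesis
  proof (intro equalityI subsetI)
    fix Y assume "Y \<in> {Y \<in> perp_sphere X r. (X \<inter> Y, join X Y) = (Z, W)}"
    then show "Y \<in> complements Z X W"
      using join_upper(2)[of Y X] Z(3) W(3) by (auto simp: perp_sphere_def complements_def)
  next
    fix Y assume "Y \<in> complements Z X W"
    then have Y: "sing Y" "Y \<subseteq> W" "X \<inter> Y = Z" "rk Y = rk X"
      using Z(3) W(3) by (auto simp: complements_def)
    have XY: "perp L X Y" by (rule singular_imp_perp[OF W(1,2) Y(2)])
    have "rk W \<le> rk (join X Y)" using rk_modular[OF X Y(1) XY] Y(3,4) Z(3) W(3) by simp
    then have "join X Y = W"
      by (intro rk_subset_eq join_least[OF W(1,2) Y(2)] sing_join X Y XY W)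
    then show "Y \<in> {Y \<in> perp_sphere X r. (X \<inter> Y, join X Y) = (Z, W)}"
      using Y XY Z(3) by (simp add: perp_sphere_def)
  qed
qed

lemma card_perp_sphere:
  assumes X: "sing X" and k: "k + r = rk X"
  shows "card (perp_sphere X r)
    = s ^ (r * r) * (card (between {} X k) * card (between X P (rk X + r)))"
proof -
  have "card (perp_sphere X r) = s ^ (r * r) * card (between {} X k \<times> between X P (rk X + r))"
  proof (rule card_eq_mult_card_fibres[where g = "\<lambda>Y. (X \<inter> Y, join X Y)"])
    show "(\<lambda>Y. (X \<inter> Y, join X Y)) ` perp_sphere X r \<subseteq> between {} X k \<times> between X P (rk X + r)"
    proof clarify
      fix Y assume Y: "Y \<in> perp_sphere X r"
      then have "sing Y" "perp L X Y" "rk (X \<inter> Y) = k" using k by (auto simp: perp_sphere_def)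
      then show "X \<inter> Y \<in> between {} X k \<and> join X Y \<in> between X P (rk X + r)"
        using rk_join_perp_sphere[OF X Y] singular_Int[OF X] sing_join[OF X] join_upper(1)
          singular_subset_points[of P L "join X Y"] by (auto simp: between_def)
    qed
    fix ZW assume "ZW \<in> between {} X k \<times> between X P (rk X + r)"
    then obtain Z W where ZW: "ZW = (Z, W)" "Z \<in> between {} X k" "W \<in> between X P (rk X + r)"
      by blast
    then have "sing Z" "Z \<subseteq> X" "sing W" "X \<subseteq> W" "rk X - rk Z = r" "rk W - rk X = r"
      using k by (auto simp: between_def)
    then show "card {Y \<in> perp_sphere X r. (X \<inter> Y, join X Y) = ZW} = s ^ (r * r)"
      unfolding ZW(1) perp_sphere_fibre[OF X ZW(2) k ZW(3)] using card_complements[OF _ X] by simp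
  qed (simp_all add: finite_perp_sphere finite_between)
  then show ?thesis by (simp add: card_cartesian_product)
qed

lemma card_between_empty_Suc:
  assumes X: "sing X" and k: "Suc k + r = rk X"
  shows "qnum s (Suc k) * card (between {} X (Suc k)) = qnum s (Suc r) * card (between {} X k)"
proof (rule card_between_Suc)
  fix Z assume "Z \<in> between {} X k"
  then have "sing Z" "Z \<subseteq> X" "rk Z = k" by (auto simp: between_def)
  then show "card (between Z X (Suc k)) = qnum s (Suc r)"
    using card_covers_within[of Z X] X k[symmetric] by (simp del: qnum.simps)
next
  fix W assume "W \<in> between {} X (Suc k)"
  then have "sing W" "rk W = Suc k" by (auto simp: between_def)
  then show "card (between {} W k) = qnum s (Suc k)"
    using card_hyperplanes_above[OF singular_empty, of W k] by (simp del: qnum.simps)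
qed

lemma card_between_points_Suc:
  assumes X: "sing X"
  shows "qnum s (Suc r) * card (between X P (rk X + Suc r))
    = polar_points (n - rk X - r) * card (between X P (rk X + r))"
  unfolding add_Suc_right
proof (rule card_between_Suc)
  fix Z assume "Z \<in> between X P (rk X + r)"
  then have "sing Z" "rk Z = rk X + r" by (auto simp: between_def)
  then show "card (between Z P (Suc (rk X + r))) = polar_points (n - rk X - r)"
    using card_covers[of Z] by simp
next
  fix W assume "W \<in> between X P (Suc (rk X + r))"
  then have "sing W" "X \<subseteq> W" "rk W = Suc (rk X + r)" by (auto simp: between_def)
  then show "card (between X W (rk X + r)) = qnum s (Suc r)"
    using card_hyperplanes_above[OF X, of W "rk X + r"] by (simp add: Suc_diff_le del: qnum.simps)
qed

lemma card_perp_sphere_Suc: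
  assumes X: "sing X"
  shows "(qnum s (Suc r))\<^sup>2 * card (perp_sphere X (Suc r))
    = s ^ (2 * r + 1) * (qnum s (rk X - r) * polar_points (n - rk X - r)) * card (perp_sphere X r)"
proof (cases "r < rk X")
  case True
  define k where "k = rk X - Suc r"
  have k: "k + Suc r = rk X" "Suc k + r = rk X" "rk X - r = Suc k" using True by (auto simp: k_def)
  have "(qnum s (Suc r))\<^sup>2 * card (perp_sphere X (Suc r)) = s ^ (Suc r * Suc r)
      * ((qnum s (Suc r) * card (between {} X k))
        * (qnum s (Suc r) * card (between X P (rk X + Suc r))))"
    unfolding card_perp_sphere[OF X k(1)] by (simp only: power2_eq_square ac_simps)
  also have "\<dots> = s ^ (Suc r * Suc r) * ((qnum s (Suc k) * card (between {} X (Suc k)))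
      * (polar_points (n - rk X - r) * card (between X P (rk X + r))))"
    unfolding card_between_empty_Suc[OF X k(2), symmetric] card_between_points_Suc[OF X] ..
  also have "s ^ (Suc r * Suc r) = s ^ (2 * r + 1) * s ^ (r * r)"
    by (simp add: power_add[symmetric] mult_2 add.assoc)
  finally show ?thesis
    unfolding card_perp_sphere[OF X k(2)] k(3) by (simp only: ac_simps)
next
  case False
  then have "perp_sphere X (Suc r) = {}" by (auto simp: perp_sphere_def)
  then show ?thesis using False by simp
qed

lemma card_adjacent:
  assumes X: "sing X" and k: "rk X = Suc k"
  shows "card {Y. sing Y \<and> rk Y = rk X \<and> rk (X \<inter> Y) = k}
    = qnum s (Suc k) * (polar_points (n - k) - 1)"
proof -
  let ?A = "{Y. sing Y \<and> rk Y = rk X \<and> rk (X \<inter> Y) = k}"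
  have "card ?A = (polar_points (n - k) - 1) * card (between {} X k)"
  proof (rule card_eq_mult_card_fibres[where g = "\<lambda>Y. X \<inter> Y"])
    show "(\<lambda>Y. X \<inter> Y) ` ?A \<subseteq> between {} X k" by (auto simp: between_def intro: singular_Int X)
    fix U assume "U \<in> between {} X k"
    then have U: "sing U" "U \<subseteq> X" "rk X = Suc (rk U)" using k by (auto simp: between_def)
    have "{Y \<in> ?A. X \<inter> Y = U} = covers U P - {X}"
    proof (intro equalityI subsetI)
      fix Y assume "Y \<in> {Y \<in> ?A. X \<inter> Y = U}"
      then have Y: "sing Y" "rk Y = rk X" "rk (X \<inter> Y) = k" "U \<subseteq> Y" by auto
      have "X \<inter> Y \<noteq> X" using Y(3) k by (metis n_not_Suc_n)
      then show "Y \<in> covers U P - {X}"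
        using Y U(3) singular_subset_points[OF Y(1)] by (auto simp: between_def)
    next
      fix Y assume "Y \<in> covers U P - {X}"
      then have "sing Y" "U \<subseteq> Y" "rk Y = Suc (rk U)" "X \<noteq> Y" by (auto simp: between_def)
      then show "Y \<in> {Y \<in> ?A. X \<inter> Y = U}"
        using Int_hyperplanes_eq[OF X _ U(1,2)] U(3) k by simp
    qed
    moreover have "X \<in> covers U P"
      using X U singular_subset_points[OF X] by (simp add: between_def)
    moreover have "rk U = k" using U(3) k by simp
    ultimately show "card {Y \<in> ?A. X \<inter> Y = U} = polar_points (n - k) - 1"
      using card_covers[OF U(1)] by (simp add: card_Diff_singleton)
  qed (simp_all add: finite_Collect_sing finite_between)
  then show ?thesis
    using card_hyperplanes_above[OF singular_empty X _ k] k
    by (simp add: mult.commute del: qnum.simps)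
qed

end

subsection \<open>Comparison of degrees\<close>

context polar_space_of_order
begin

lemma qnum_Suc_mult_polar_points_le:
  assumes "y \<le> x"
  shows "qnum s (Suc x) * polar_points y \<le> qnum s x * polar_points (Suc y)"
proof -
  have "qnum s (Suc x) * qnum s y \<le> qnum s x * qnum s (Suc y)"
    using assms by (simp add: algebra_simps)
  moreover have "t * s ^ (y - 1) + 1 \<le> t * s ^ y + 1"
    using s_gt_1 by (simp add: power_increasing)
  ultimately have "(qnum s (Suc x) * qnum s y) * (t * s ^ (y - 1) + 1)
      \<le> (qnum s x * qnum s (Suc y)) * (t * s ^ y + 1)" by (rule mult_le_mono)
  then show ?thesis by (simp only: polar_points_def mult.assoc diff_Suc_1)
qed

lemma qnum_mult_polar_points_le:
  assumes "y + d \<le> Suc x"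
  shows "qnum s (x + d) * polar_points y \<le> qnum s x * polar_points (y + d)"
  using assms
proof (induction d arbitrary: y)
  case (Suc d)
  have "qnum s (x + Suc d) * polar_points y \<le> qnum s (x + d) * polar_points (Suc y)"
    using qnum_Suc_mult_polar_points_le[of y "x + d"] Suc.prems by simp
  also have "\<dots> \<le> qnum s x * polar_points (Suc y + d)" by (rule Suc.IH) (use Suc.prems in simp)
  finally show ?case by simp
qed simp

lemma qnum_ge_1: "0 < k \<Longrightarrow> 1 \<le> qnum s k"
  by (cases k) auto

lemma polar_points_ge_2:
  assumes "0 < c" shows "2 \<le> polar_points c"
proof -
  have "1 \<le> qnum s c" by (rule qnum_ge_1[OF assms])
  moreover have "0 < t * s ^ (c - 1)" using t_pos by simp
  then have "2 \<le> t * s ^ (c - 1) + 1" by linarith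
  ultimately have "1 * 2 \<le> qnum s c * (t * s ^ (c - 1) + 1)" by (rule mult_le_mono)
  then show ?thesis by (simp add: polar_points_def)
qed

lemma qnum_Suc_square_less: "(qnum s (Suc r))\<^sup>2 < 2 * s ^ (2 * r + 1)"
proof -
  have "qnum s (Suc r) < 2 * s ^ r"
  proof (induction r)
    case (Suc r)
    then have "s * (qnum s (Suc r) + 1) \<le> s * (2 * s ^ r)" by (intro mult_le_mono2) simp
    then show ?case using s_gt_1 by (simp add: algebra_simps)
  qed simp
  then have "(qnum s (Suc r))\<^sup>2 < (2 * s ^ r)\<^sup>2" by (intro power_strict_mono) auto
  also have "\<dots> = 2 * (2 * s ^ (2 * r))"
    by (simp add: power_mult_distrib power_mult mult.commute[of 2])
  also have "\<dots> \<le> 2 * (s * s ^ (2 * r))" using s_gt_1 by (intro mult_le_mono2 mult_le_mono1) simp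
  finally show ?thesis by simp
qed

lemma card_perp_sphere_antimono:
  assumes X: "sing X" and X': "sing X'" and "rk X \<le> rk X'" "n \<le> 2 * rk X"
  shows "card (perp_sphere X' r) \<le> card (perp_sphere X r)"
proof (induction r)
  case (Suc r)
  have "qnum s (rk X' - r) * polar_points (n - rk X' - r)
      \<le> qnum s (rk X - r) * polar_points (n - rk X - r)" (is "?f' \<le> ?f")
  proof (cases "r < n - rk X'")
    case True
    define d where "d = rk X' - rk X"
    have "rk X' - r = rk X - r + d" "n - rk X - r = n - rk X' - r + d"
      using True assms rk_le_n[OF X'] by (auto simp: d_def)
    then show ?thesis
      using qnum_mult_polar_points_le[of "n - rk X' - r" d "rk X - r"] assms(4) by simp
  qed (simp add: polar_points_def)
  then have "s ^ (2 * r + 1) * ?f' * card (perp_sphere X' r)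
      \<le> s ^ (2 * r + 1) * ?f * card (perp_sphere X r)"
    by (rule mult_le_mono[OF mult_le_mono2 Suc.IH])
  then have "(qnum s (Suc r))\<^sup>2 * card (perp_sphere X' (Suc r))
      \<le> (qnum s (Suc r))\<^sup>2 * card (perp_sphere X (Suc r))"
    by (simp only: card_perp_sphere_Suc X X')
  then show ?case by simp
qed (simp add: perp_sphere_0 X X')

lemma card_perp_sphere_less_Suc:
  assumes X: "sing X" and "n \<le> 2 * rk X" "r < n - rk X" and pos: "0 < card (perp_sphere X r)"
  shows "card (perp_sphere X r) < card (perp_sphere X (Suc r))"
proof -
  let ?f = "qnum s (rk X - r) * polar_points (n - rk X - r)"
  have "1 \<le> qnum s (rk X - r)" using assms(2,3) by (intro qnum_ge_1) simp
  moreover have "2 \<le> polar_points (n - rk X - r)" using assms(3) by (intro polar_points_ge_2) simp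
  ultimately have "1 * 2 \<le> ?f" by (rule mult_le_mono)
  then have "s ^ (2 * r + 1) * 2 \<le> s ^ (2 * r + 1) * ?f" by (intro mult_le_mono2) simp
  then have "(qnum s (Suc r))\<^sup>2 < s ^ (2 * r + 1) * ?f" using qnum_Suc_square_less[of r] by linarith
  then have "(qnum s (Suc r))\<^sup>2 * card (perp_sphere X r)
      < (qnum s (Suc r))\<^sup>2 * card (perp_sphere X (Suc r))"
    unfolding card_perp_sphere_Suc[OF X] using pos by (rule mult_strict_right_mono)
  then show ?thesis by simp
qed

lemma card_perp_sphere_pos:
  assumes X: "sing X" and half: "n \<le> 2 * rk X" and "r \<le> n - rk X"
  shows "0 < card (perp_sphere X r)"
  using assms(3)
proof (induction r)
  case (Suc r)
  then show ?case using card_perp_sphere_less_Suc[OF X half, of r] by simp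
qed (simp add: perp_sphere_0 X)

lemma card_perp_sphere_less:
  assumes X: "sing X" and half: "n \<le> 2 * rk X" and "r < r'" "r' \<le> n - rk X"
  shows "card (perp_sphere X r) < card (perp_sphere X r')"
proof (rule lift_Suc_mono_less_ivl[of "{..<n - rk X}" "\<lambda>r. card (perp_sphere X r)"])
  show "card (perp_sphere X k) < card (perp_sphere X (Suc k))" if "k \<in> {..<n - rk X}" for k
    using that by (intro card_perp_sphere_less_Suc card_perp_sphere_pos X half) auto
qed (use assms(3,4) in auto)

lemma perp_sphere_empty:
  assumes X: "sing X" and r: "n - rk X < r"
  shows "perp_sphere X r = {}"
proof -
  have False if Y: "Y \<in> perp_sphere X r" for Y
  proof -
    have "sing Y" "perp L X Y" using Y by (simp_all add: perp_sphere_def)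
    then have "rk X + r \<le> n"
      using rk_le_n[OF sing_join[OF X]] rk_join_perp_sphere[OF X Y] by metis
    then show False using r by simp
  qed
  then show ?thesis by blast
qed

lemma card_UN_perp_sphere:
  "finite I \<Longrightarrow> card (\<Union>r\<in>I. perp_sphere X r) = (\<Sum>r\<in>I. card (perp_sphere X r))"
  by (rule card_UN_disjoint) (auto simp: finite_perp_sphere, auto simp: perp_sphere_def)

lemma perp_sphereE:
  assumes "sing X" "sing Y" "rk Y = rk X" "perp L X Y"
  obtains r where "r \<le> n" "Y \<in> perp_sphere X r"
proof
  have "rk (X \<inter> Y) \<le> rk X" using assms by (intro rk_mono singular_Int) auto
  then show "Y \<in> perp_sphere X (rk X - rk (X \<inter> Y))" using assms by (simp add: perp_sphere_def)
  show "rk X - rk (X \<inter> Y) \<le> n" using rk_le_n[OF assms(1)] by simp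
qed

lemma Delta_eq: "Delta P L u = {X. sing X \<and> rk X = Suc u}"
  by (auto simp: Delta_def proj_dim_eq_rk)

lemma hyp_adjacent_iff: "hyp_adjacent P L u X Y \<longleftrightarrow> rk (X \<inter> Y) = u"
  by (simp add: hyp_adjacent_def proj_dim_eq_rk)

lemma Delta_nonempty:
  assumes "Suc u \<le> n" shows "Delta P L u \<noteq> {}"
proof -
  obtain M where "sing M" "rk M = n" "{} \<subseteq> M" using maximal_aboveE[OF singular_empty] .
  then have "between {} M (Suc u) \<noteq> {}" using assms by (intro between_nonempty singular_empty) auto
  then show ?thesis by (auto simp: between_def Delta_eq)
qed

lemma perp_neighbours_eq:
  assumes X: "X \<in> Delta P L u"
  shows "{Y \<in> Delta P L u. Y \<noteq> X \<and> perp L X Y} = (\<Union>r\<in>{1..n}. perp_sphere X r)"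
proof (intro equalityI subsetI)
  have X: "sing X" "rk X = Suc u" using X by (auto simp: Delta_eq)
  fix Y assume "Y \<in> {Y \<in> Delta P L u. Y \<noteq> X \<and> perp L X Y}"
  then have Y: "sing Y" "rk Y = rk X" "perp L X Y" "Y \<noteq> X" using X by (auto simp: Delta_eq)
  obtain r where r: "r \<le> n" "Y \<in> perp_sphere X r" using perp_sphereE[OF X(1) Y(1-3)] .
  then have "r \<noteq> 0" using perp_sphere_0[OF X(1)] Y(4) by (intro notI) simp
  then have "r \<in> {1..n}" using r(1) by simp
  then show "Y \<in> (\<Union>r\<in>{1..n}. perp_sphere X r)" using r(2) by blast
next
  fix Y assume "Y \<in> (\<Union>r\<in>{1..n}. perp_sphere X r)"
  then show "Y \<in> {Y \<in> Delta P L u. Y \<noteq> X \<and> perp L X Y}"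
    using X by (auto simp: perp_sphere_def Delta_eq)
qed

lemma perp_degree_less:
  assumes X: "X \<in> Delta P L i" and X': "X' \<in> Delta P L j" and ij: "i < j" "n \<le> 2 * Suc i"
  shows "card {Y \<in> Delta P L j. Y \<noteq> X' \<and> perp L X' Y} < card {Y \<in> Delta P L i. Y \<noteq> X \<and> perp L X Y}"
proof -
  have rk: "sing X" "rk X = Suc i" "sing X'" "rk X' = Suc j" using X X' by (auto simp: Delta_eq)
  have "(\<Sum>r = 1..n. card (perp_sphere X' r)) < (\<Sum>r = 1..n. card (perp_sphere X r))"
  proof (rule sum_strict_mono_ex1)
    show "\<forall>r\<in>{1..n}. card (perp_sphere X' r) \<le> card (perp_sphere X r)"
      using rk ij by (intro ballI card_perp_sphere_antimono) auto
    have codim_less: "n - rk X' < n - rk X" using rk ij rk_le_n[OF rk(3)] by simp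
    then have "card (perp_sphere X' (n - rk X)) < card (perp_sphere X (n - rk X))"
      using perp_sphere_empty[OF rk(3)] card_perp_sphere_pos[OF rk(1)] rk(2) ij by simp
    then show "\<exists>r\<in>{1..n}. card (perp_sphere X' r) < card (perp_sphere X r)"
      using codim_less by (intro bexI[of _ "n - rk X"]) auto
  qed simp
  then show ?thesis
    unfolding perp_neighbours_eq[OF X] perp_neighbours_eq[OF X'] by (simp add: card_UN_perp_sphere)
qed

lemma adjacent_neighbours_eq:
  assumes X: "X \<in> Delta P L u"
  shows "{Y \<in> Delta P L u. Y \<noteq> X \<and> hyp_adjacent P L u X Y}
    = {Y. sing Y \<and> rk Y = rk X \<and> rk (X \<inter> Y) = u}"
proof -
  have rk: "rk X = Suc u" using X by (simp add: Delta_eq)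
  then have "Y \<noteq> X" if "rk (X \<inter> Y) = u" for Y
    using that by (metis Int_absorb n_not_Suc_n)
  then show ?thesis unfolding Delta_eq hyp_adjacent_iff rk by blast
qed

lemma perp_or_adjacent_degree:
  assumes X: "X \<in> Delta P L u"
  shows "card {Y \<in> Delta P L u. Y \<noteq> X \<and> (perp L X Y \<or> hyp_adjacent P L u X Y)}
    = qnum s (Suc u) * (polar_points (n - u) - 1) + (\<Sum>r = 2..n. card (perp_sphere X r))"
proof -
  let ?A = "{Y. sing Y \<and> rk Y = rk X \<and> rk (X \<inter> Y) = u}"
  have X': "sing X" "rk X = Suc u" using X by (simp_all add: Delta_eq)
  have "1 \<le> n" using X' rk_le_n[OF X'(1)] by simp
  have "perp_sphere X 1 \<subseteq> ?A" using X'(2) by (simp add: perp_sphere_def subset_iff)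
  moreover have "{1..n} = insert 1 {2..n}" using \<open>1 \<le> n\<close> by auto
  ultimately have "(\<Union>r\<in>{1..n}. perp_sphere X r) \<union> ?A = ?A \<union> (\<Union>r\<in>{2..n}. perp_sphere X r)" by auto
  then have "{Y \<in> Delta P L u. Y \<noteq> X \<and> (perp L X Y \<or> hyp_adjacent P L u X Y)}
      = ?A \<union> (\<Union>r\<in>{2..n}. perp_sphere X r)"
    unfolding perp_neighbours_eq[OF X, symmetric] adjacent_neighbours_eq[OF X, symmetric] by blast
  moreover have "card (?A \<union> (\<Union>r\<in>{2..n}. perp_sphere X r))
      = card ?A + card (\<Union>r\<in>{2..n}. perp_sphere X r)"
  proof (rule card_Un_disjoint)
    show "?A \<inter> (\<Union>r\<in>{2..n}. perp_sphere X r) = {}" using X'(2) by (auto simp: perp_sphere_def)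
  qed (simp_all add: finite_Collect_sing finite_perp_sphere)
  moreover have "card ?A = qnum s (Suc u) * (polar_points (n - u) - 1)"
    by (rule card_adjacent[OF X'])
  moreover have "card (\<Union>r\<in>{2..n}. perp_sphere X r) = (\<Sum>r = 2..n. card (perp_sphere X r))"
    by (rule card_UN_perp_sphere) simp
  ultimately show ?thesis by (simp only:)
qed

lemma perp_or_adjacent_degree_less:
  assumes X: "X \<in> Delta P L i" and X': "X' \<in> Delta P L j" and ij: "i < j" "n \<le> 2 * Suc i"
  shows "card {Y \<in> Delta P L j. Y \<noteq> X' \<and> (perp L X' Y \<or> hyp_adjacent P L j X' Y)}
    < card {Y \<in> Delta P L i. Y \<noteq> X \<and> (perp L X Y \<or> hyp_adjacent P L i X Y)}"
  unfolding perp_or_adjacent_degree[OF X] perp_or_adjacent_degree[OF X']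
proof (rule add_less_le_mono)
  have rk: "sing X" "rk X = Suc i" "sing X'" "rk X' = Suc j" using X X' by (auto simp: Delta_eq)
  show "(\<Sum>r = 2..n. card (perp_sphere X' r)) \<le> (\<Sum>r = 2..n. card (perp_sphere X r))"
    using rk ij by (intro sum_mono card_perp_sphere_antimono) auto
  have j_less_n: "j < n" using rk_le_n[OF rk(3)] rk(4) by simp
  have "qnum s (Suc i + (j - i)) * polar_points (n - j)
      \<le> qnum s (Suc i) * polar_points (n - j + (j - i))"
    using ij j_less_n by (intro qnum_mult_polar_points_le) simp
  then have "qnum s (Suc j) * polar_points (n - j) \<le> qnum s (Suc i) * polar_points (n - i)"
    using ij j_less_n by (simp del: qnum.simps)
  moreover have "qnum s (Suc i) < qnum s (Suc j)" using ij by (simp del: qnum.simps)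
  moreover have "qnum s (Suc j) * 2 \<le> qnum s (Suc j) * polar_points (n - j)"
    using j_less_n by (intro mult_le_mono2 polar_points_ge_2) simp
  ultimately show "qnum s (Suc j) * (polar_points (n - j) - 1)
      < qnum s (Suc i) * (polar_points (n - i) - 1)"
    unfolding diff_mult_distrib2 by linarith
qed

lemma perp_max_neighbours_eq:
  assumes "X \<in> Delta P L u"
  shows "{Y \<in> Delta P L u. Y \<noteq> X \<and> perp_max P L n X Y} = perp_sphere X (n - rk X) - {X}"
proof -
  have X: "sing X" "rk X = Suc u" using assms by (auto simp: Delta_eq)
  have "rk (join X Y) = n \<longleftrightarrow> rk (X \<inter> Y) + (n - rk X) = rk X"
    if "sing Y" "rk Y = rk X" "perp L X Y" for Y
    using rk_modular[OF X(1) that(1,3)] that(2) rk_le_n[OF X(1)]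
      rk_le_n[OF sing_join[OF X(1) that(1,3)]] by linarith
  then show ?thesis
    using X unfolding Delta_eq perp_max_def perp_sphere_def proj_dim_eq_rk join_def[symmetric]
    by auto
qed

lemma perp_max_degree_less:
  assumes X: "X \<in> Delta P L i" and X': "X' \<in> Delta P L j" and ij: "i < j" "n \<le> 2 * Suc i"
  shows "card {Y \<in> Delta P L j. Y \<noteq> X' \<and> perp_max P L n X' Y}
    < card {Y \<in> Delta P L i. Y \<noteq> X \<and> perp_max P L n X Y}"
  unfolding perp_max_neighbours_eq[OF X] perp_max_neighbours_eq[OF X']
proof -
  have rk: "sing X" "rk X = Suc i" "sing X'" "rk X' = Suc j" using X X' by (auto simp: Delta_eq)
  have codim_less: "n - rk X' < n - rk X" using rk ij rk_le_n[OF rk(3)] by simp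
  have "card (perp_sphere X' (n - rk X') - {X'}) \<le> card (perp_sphere X' (n - rk X'))"
    by (rule card_Diff1_le)
  also have "\<dots> \<le> card (perp_sphere X (n - rk X'))"
    using rk ij by (intro card_perp_sphere_antimono) auto
  also have "\<dots> < card (perp_sphere X (n - rk X))"
    using rk ij codim_less by (intro card_perp_sphere_less) auto
  also have "perp_sphere X (n - rk X) = perp_sphere X (n - rk X) - {X}"
    using codim_less by (auto simp: perp_sphere_def)
  finally show "card (perp_sphere X' (n - rk X') - {X'}) < card (perp_sphere X (n - rk X) - {X})" .
qed

end

lemma out_degree_graph_of:
  assumes "X \<in> V"
  shows "out_degree (with_proj (graph_of V R)) X = card {Y \<in> V. Y \<noteq> X \<and> R X Y}"
proof -
  have "out_arcs (with_proj (graph_of V R)) X = Pair X ` {Y \<in> V. Y \<noteq> X \<and> R X Y}"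
    using assms by (auto simp: out_arcs_def graph_of_def)
  then show ?thesis by (simp add: out_degree_def card_image inj_on_def)
qed

lemma not_graph_iso_if_degree_less:
  assumes "V \<noteq> {}" "\<And>X X'. \<lbrakk>X \<in> V; X' \<in> W\<rbrakk> \<Longrightarrow>
    card {Y \<in> W. Y \<noteq> X' \<and> S X' Y} < card {Y \<in> V. Y \<noteq> X \<and> R X Y}"
  shows "\<not> graph_iso (graph_of V R) (graph_of W S)"
proof
  let ?G = "with_proj (graph_of V R)" and ?H = "with_proj (graph_of W S)"
  assume "digraph_iso ?G ?H"
  then obtain h where h: "pre_digraph.digraph_isomorphism ?G h" "?H = app_iso h ?G"
    unfolding digraph_iso_def by blast
  then interpret wf_digraph ?G by (simp add: pre_digraph.digraph_isomorphism_def)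
  obtain X where X: "X \<in> V" using assms(1) by blast
  define X' where "X' = iso_verts h X"
  have "X' \<in> verts ?H" using X unfolding h(2) by (simp add: X'_def graph_of_def app_iso_def)
  then have X': "X' \<in> W" by (simp add: graph_of_def)
  have "out_degree ?H X' = out_degree ?G X"
    unfolding h(2) X'_def using X by (intro out_degree_app_iso_eq[OF h(1)]) (simp add: graph_of_def)
  then show False using assms(2)[OF X X'] by (simp add: out_degree_graph_of X X')
qed

theorem theorem1p9:
  fixes P :: "'a set" and L :: "'a set set" and n s t i j :: nat
  assumes "finite_polar_space P L"
    and "n \<ge> 3"
    and "has_polar_rank P L n"
    and "has_polar_order P L n s t"
    and "(real n - 2) / 2 \<le> real i"
    and "i < j"
    and "j \<le> n - 1"
  shows "\<not> graph_iso (graph_of (Delta P L i) (perp L)) (graph_of (Delta P L j) (perp L)) \<and>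
    \<not> graph_iso
        (graph_of (Delta P L i) (\<lambda>X Y. perp L X Y \<or> hyp_adjacent P L i X Y))
        (graph_of (Delta P L j) (\<lambda>X Y. perp L X Y \<or> hyp_adjacent P L j X Y)) \<and>
    \<not> graph_iso
        (graph_of (Delta P L i) (perp_max P L n))
        (graph_of (Delta P L j) (perp_max P L n))"
proof -
  interpret polar_space_of_order P L n s t
    by (intro polar_space_of_order.intro polar_space_of_order_axioms.intro assms(1,3,4))
  have half: "n \<le> 2 * Suc i" using assms(5) by simp
  have "Delta P L i \<noteq> {}" using assms(6,7) by (intro Delta_nonempty) simp
  then show ?thesis
    using perp_degree_less perp_or_adjacent_degree_less perp_max_degree_less assms(6) half
    by (intro conjI not_graph_iso_if_degree_less)
qed

end
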